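(* Let $C_n$ be the cycle graph on $n$ vertices. Then $$\lim_{n\to\infty}\frac{\operatorname{Vol}(\bar{\Sigma}(C_n))}{\operatorname{Vol}(\bar{\mathcal{P}}(C_n))}=1 .$$
   Context: For a finite simple undirected graph $G$ with vertex set $[n]$, $\mathrm{Sym}(G)=\mathbb{R}^{V(G)+E(G)}$ is the space of partially specified symmetric $n\times n$ real matrices: $A\in\mathrm{Sym}(G)$ specifies the diagonal entries $A_{ii}$ and the entries $A_{ij}=A_{ji}$ for $\{i,j\}\in E(G)$, the others being unspecified. $\mathrm{tr}(A)=\sum_i A_{ii}$. $\Sigma(G)$ is the set of $A\in\mathrm{Sym}(G)$ for which there is a real symmetric positive semidefinite (PSD) $n\times n$ matrix agreeing with $A$ on all specified entries. $\mathcal{P}(G)$ is the set of $A\in \mathrm{Sym}(G)$ such that for every maximal clique $K$ of $G$ the (fully specified) principal submatrix of $A$ indexed by $K$ is PSD. $\bar{\Sigma}(G)$ and $\bar{\mathcal{P}}(G)$ are the intersections of $\Sigma(G)$ and $\mathcal{P}(G)$ with the affine hyperplane $\{A\in\mathrm{Sym}(G):\mathrm{tr}(A)=1\}$, and $\operatorname{Vol}$ is Lebesgue measure on this hyperplane. *)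

theory Defs
  imports "HOL-Analysis.Analysis"
begin

text \<open>
  A graph on the vertex set \<open>[n] = {1..n}\<close> is given by \<open>n\<close> and its set \<open>E\<close> of edges, an edge being
  a two-element set of vertices.
\<close>

definition simple_graph :: "nat \<Rightarrow> nat set set \<Rightarrow> bool" where
  "simple_graph n E \<longleftrightarrow> E \<subseteq> {e. e \<subseteq> {1..n} \<and> card e = 2}"

text \<open>The cycle is a simple graph only for \<open>n \<ge> 3\<close>; smaller \<open>n\<close> are irrelevant in a limit.\<close>

definition cycle_edges :: "nat \<Rightarrow> nat set set" where
  "cycle_edges n = {{i, i + 1} | i. 1 \<le> i \<and> i < n} \<union> {{n, 1}}"

lemma simple_graph_cycle_edges:
  assumes "n \<ge> 3"
  shows "simple_graph n (cycle_edges n)"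
  using assms by (auto simp: simple_graph_def cycle_edges_def card_insert_if)

lemma card_cycle_edges:
  assumes "n \<ge> 3"
  shows "card (cycle_edges n) = n"
proof -
  have eq: "cycle_edges n = (\<lambda>i. {i, i + 1}) ` {1..<n} \<union> {{n, 1}}"
    by (auto simp: cycle_edges_def)
  have inj: "inj_on (\<lambda>i::nat. {i, i + 1}) {1..<n}"
    by (auto simp: inj_on_def doubleton_eq_iff)
  have nin: "{n, 1} \<notin> (\<lambda>i. {i, i + 1}) ` {1..<n}"
    using assms by (auto simp: doubleton_eq_iff)
  show ?thesis
    using assms nin by (simp add: eq card_image[OF inj] del: One_nat_def)
qed

definition is_clique :: "nat \<Rightarrow> nat set set \<Rightarrow> nat set \<Rightarrow> bool" where
  "is_clique n E K \<longleftrightarrow> K \<subseteq> {1..n} \<and> (\<forall>i\<in>K. \<forall>j\<in>K. i \<noteq> j \<longrightarrow> {i, j} \<in> E)"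

definition is_maximal_clique :: "nat \<Rightarrow> nat set set \<Rightarrow> nat set \<Rightarrow> bool" where
  "is_maximal_clique n E K \<longleftrightarrow>
     is_clique n E K \<and> (\<forall>K'. is_clique n E K' \<and> K \<subseteq> K' \<longrightarrow> K' = K)"

text \<open>
  Matrices with rows and columns indexed by a finite set \<open>K\<close> are functions of two indices of which
  only the values on \<open>K\<close> matter.
\<close>

definition psd_on :: "nat set \<Rightarrow> (nat \<Rightarrow> nat \<Rightarrow> real) \<Rightarrow> bool" where
  "psd_on K M \<longleftrightarrow>
     (\<forall>i\<in>K. \<forall>j\<in>K. M i j = M j i) \<and>
     (\<forall>x::nat \<Rightarrow> real. 0 \<le> (\<Sum>i\<in>K. \<Sum>j\<in>K. x i * M i j * x j))"

text \<open>
  Partial symmetric matrices: elements of \<open>\<real>\<^bsup>V + E\<^esup>\<close>, where \<open>Inl i\<close> indexes the entry \<open>(i, i)\<close> and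
  \<open>Inr {i, j}\<close> the entry \<open>(i, j)\<close>.
\<close>

type_synonym pmat = "nat + nat set \<Rightarrow> real"

definition indices :: "nat \<Rightarrow> nat set set \<Rightarrow> (nat + nat set) set" where
  "indices n E = {1..n} <+> E"

definition Sym :: "nat \<Rightarrow> nat set set \<Rightarrow> pmat set" where
  "Sym n E = indices n E \<rightarrow>\<^sub>E UNIV"

definition entry :: "pmat \<Rightarrow> nat \<Rightarrow> nat \<Rightarrow> real" where
  "entry A i j = (if i = j then A (Inl i) else A (Inr {i, j}))"

definition tr :: "nat \<Rightarrow> pmat \<Rightarrow> real" where
  "tr n A = (\<Sum>i=1..n. entry A i i)"

definition SigmaG :: "nat \<Rightarrow> nat set set \<Rightarrow> pmat set" where
  "SigmaG n E = {A \<in> Sym n E. \<exists>M. psd_on {1..n} M \<and>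
     (\<forall>i\<in>{1..n}. \<forall>j\<in>{1..n}. i = j \<or> {i, j} \<in> E \<longrightarrow> M i j = entry A i j)}"

definition PG :: "nat \<Rightarrow> nat set set \<Rightarrow> pmat set" where
  "PG n E = {A \<in> Sym n E. \<forall>K. is_maximal_clique n E K \<longrightarrow> psd_on K (entry A)}"

definition trace_hyperplane :: "nat \<Rightarrow> nat set set \<Rightarrow> pmat set" where
  "trace_hyperplane n E = {A \<in> Sym n E. tr n A = 1}"

definition Sigma_bar :: "nat \<Rightarrow> nat set set \<Rightarrow> pmat set" where
  "Sigma_bar n E = SigmaG n E \<inter> trace_hyperplane n E"

definition P_bar :: "nat \<Rightarrow> nat set set \<Rightarrow> pmat set" where
  "P_bar n E = PG n E \<inter> trace_hyperplane n E"

text \<open>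
  The hyperplane is the graph of the affine function \<open>A\<^sub>1\<^sub>1 = 1 - A\<^sub>2\<^sub>2 - \<dots> - A\<^sub>n\<^sub>n\<close> of the remaining
  coordinates. Its Euclidean Lebesgue measure is the image of the Lebesgue measure in these
  coordinates, multiplied by \<open>sqrt (1 + (n - 1)) = sqrt n\<close>, as the gradient of that function has
  \<open>n - 1\<close> entries \<open>-1\<close> and is otherwise zero.
\<close>

definition free_indices :: "nat \<Rightarrow> nat set set \<Rightarrow> (nat + nat set) set" where
  "free_indices n E = indices n E - {Inl 1}"

definition hyperplane_chart :: "nat \<Rightarrow> pmat \<Rightarrow> pmat" where
  "hyperplane_chart n x = x(Inl 1 := 1 - (\<Sum>i=2..n. x (Inl i)))"

definition hyperplane_lebesgue :: "nat \<Rightarrow> nat set set \<Rightarrow> pmat measure" where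
  "hyperplane_lebesgue n E = completion (scale_measure (ennreal (sqrt (real n)))
     (distr (\<Pi>\<^sub>M k\<in>free_indices n E. lborel)
            (restrict_space (\<Pi>\<^sub>M k\<in>indices n E. lborel) (trace_hyperplane n E))
            (hyperplane_chart n)))"

definition Vol :: "nat \<Rightarrow> nat set set \<Rightarrow> pmat set \<Rightarrow> real" where
  "Vol n E S = measure (hyperplane_lebesgue n E) S"

lemma tr_conv:
  assumes "n \<ge> 1"
  shows "tr n A = A (Inl 1) + (\<Sum>i=2..n. A (Inl i))"
  using assms by (simp add: tr_def entry_def sum.atLeast_Suc_atMost numeral_2_eq_2)

lemma chart_in_hyperplane:
  assumes "n \<ge> 1" "x \<in> free_indices n E \<rightarrow>\<^sub>E UNIV"
  shows "hyperplane_chart n x \<in> trace_hyperplane n E"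
proof -
  have "(\<Sum>i=2..n. hyperplane_chart n x (Inl i)) = (\<Sum>i=2..n. x (Inl i))"
    by (intro sum.cong) (auto simp: hyperplane_chart_def)
  then show ?thesis
    using assms
    by (auto simp: trace_hyperplane_def Sym_def tr_conv hyperplane_chart_def PiE_iff
        extensional_def free_indices_def indices_def)
qed

lemma bij_betw_hyperplane_chart:
  assumes "n \<ge> 1"
  shows "bij_betw (hyperplane_chart n) (free_indices n E \<rightarrow>\<^sub>E UNIV) (trace_hyperplane n E)"
proof (rule bij_betw_imageI)
  show "inj_on (hyperplane_chart n) (free_indices n E \<rightarrow>\<^sub>E UNIV)"
  proof (rule inj_onI)
    fix x y assume x: "x \<in> free_indices n E \<rightarrow>\<^sub>E UNIV" and y: "y \<in> free_indices n E \<rightarrow>\<^sub>E UNIV"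
      and eq: "hyperplane_chart n x = hyperplane_chart n y"
    show "x = y"
    proof
      fix k
      show "x k = y k"
      proof (cases "k = Inl 1")
        case True
        then show ?thesis
          using x y by (simp add: PiE_iff extensional_def free_indices_def)
      next
        case False
        then show ?thesis
          using fun_cong[OF eq, of k] by (simp add: hyperplane_chart_def)
      qed
    qed
  qed
next
  show "hyperplane_chart n ` (free_indices n E \<rightarrow>\<^sub>E UNIV) = trace_hyperplane n E"
  proof (intro equalityI subsetI)
    fix A assume "A \<in> hyperplane_chart n ` (free_indices n E \<rightarrow>\<^sub>E UNIV)"
    then show "A \<in> trace_hyperplane n E"
      using chart_in_hyperplane[OF assms] by blast
  next
    fix A assume A: "A \<in> trace_hyperplane n E"
    let ?x = "A(Inl 1 := undefined)"
    have "(\<Sum>i=2..n. ?x (Inl i)) = (\<Sum>i=2..n. A (Inl i))"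
      by (intro sum.cong) auto
    then have "hyperplane_chart n ?x = A"
      using A assms by (auto simp: hyperplane_chart_def trace_hyperplane_def tr_conv)
    moreover have "?x \<in> free_indices n E \<rightarrow>\<^sub>E UNIV"
      using A by (auto simp: trace_hyperplane_def Sym_def PiE_iff extensional_def free_indices_def)
    ultimately show "A \<in> hyperplane_chart n ` (free_indices n E \<rightarrow>\<^sub>E UNIV)"
      by (metis imageI)
  qed
qed

lemma measurable_hyperplane_chart:
  assumes "n \<ge> 1"
  shows "hyperplane_chart n \<in>
    measurable (\<Pi>\<^sub>M k\<in>free_indices n E. lborel)
      (restrict_space (\<Pi>\<^sub>M k\<in>indices n E. lborel) (trace_hyperplane n E))"
proof (rule measurable_restrict_space2)
  show "hyperplane_chart n \<in> space (\<Pi>\<^sub>M k\<in>free_indices n E. lborel) \<rightarrow> trace_hyperplane n E"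
    using chart_in_hyperplane[OF assms] by (auto simp: space_PiM)
next
  have idx: "insert (Inl 1) (free_indices n E) = indices n E"
    using assms by (auto simp: free_indices_def indices_def)
  have "Inl i \<in> free_indices n E" if "i \<in> {2..n}" for i
    using that by (auto simp: free_indices_def indices_def)
  then have "(\<lambda>x. 1 - (\<Sum>i=2..n. x (Inl i))) \<in> borel_measurable (\<Pi>\<^sub>M k\<in>free_indices n E. lborel)"
    by (intro borel_measurable_diff borel_measurable_sum borel_measurable_const)
       (metis measurable_component_singleton measurable_lborel1)
  then have "(\<lambda>x. x(Inl 1 := 1 - (\<Sum>i=2..n. x (Inl i)))) \<in>
      measurable (\<Pi>\<^sub>M k\<in>free_indices n E. lborel) (\<Pi>\<^sub>M k\<in>insert (Inl 1) (free_indices n E). lborel)"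
    by (intro measurable_fun_upd[where J = "free_indices n E"]) (auto simp: free_indices_def)
  then show "hyperplane_chart n \<in>
      measurable (\<Pi>\<^sub>M k\<in>free_indices n E. lborel) (\<Pi>\<^sub>M k\<in>indices n E. lborel)"
    unfolding idx hyperplane_chart_def[abs_def] .
qed

end

theory Submission imports Defs begin

text \<open>
  For \<open>n \<ge> 4\<close> the maximal cliques of the cycle are its edges, so \<open>A\<close> lies in \<open>P_bar\<close> iff its diagonal
  \<open>a\<close> is nonnegative of sum \<open>1\<close> and its edge entries satisfy \<open>\<bar>e\<^sub>i\<bar> \<le> r\<^sub>i = sqrt (a\<^sub>i a\<^sub>i\<^sub>+\<^sub>1)\<close>. If three of
  the edges satisfy \<open>\<bar>e\<^sub>i\<bar> \<le> r\<^sub>i / 2\<close>, then \<open>A\<close> has a PSD completion: the completable correlations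
  \<open>t\<^sub>i = e\<^sub>i / r\<^sub>i\<close> form a convex set, so the other correlations may be assumed to be \<open>\<plusminus>1\<close>, which contracts
  the cycle to a triangle. For a fixed diagonal the edge entries of \<open>P_bar\<close> fill a box, of which at
  most the fraction \<open>4 n\<^sup>2 / 2\<^sup>n\<close> has \<open>\<bar>e\<^sub>i\<bar> > r\<^sub>i / 2\<close> for all but two edges; integrating over
  the diagonals, \<open>Sigma_bar\<close> fills at least the fraction \<open>1 - 4 n\<^sup>2 / 2\<^sup>n\<close> of \<open>P_bar\<close>.
\<close>

section \<open>The cycle graph: edges and cliques\<close>

text \<open>Edge number \<open>i\<close> joins \<open>i\<close> to \<open>cyc_succ n i\<close>, so
  that data on the edges become families indexed by \<open>{1..n}\<close>.\<close>

definition cyc_succ :: "nat \<Rightarrow> nat \<Rightarrow> nat" where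
  "cyc_succ n i = (if i = n then 1 else i + 1)"

lemma cycle_edges_eq:
  assumes "n \<ge> 1"
  shows "cycle_edges n = (\<lambda>i. {i, cyc_succ n i}) ` {1..n}"
proof -
  have "{1..n} = {1..<n} \<union> {n}" using assms by auto
  then show ?thesis
    unfolding cycle_edges_def cyc_succ_def by (auto simp: image_iff)
qed

lemma cyc_succ_in: "i \<in> {1..n} \<Longrightarrow> cyc_succ n i \<in> {1..n}"
  by (auto simp: cyc_succ_def)

lemma cyc_succ_neq: "n \<ge> 2 \<Longrightarrow> cyc_succ n i \<noteq> i"
  by (auto simp: cyc_succ_def)

text \<open>Fails for \<open>n = 2\<close>, where both indices give the edge
  \<open>{1, 2}\<close>.\<close>

lemma inj_on_cycle_edge:
  assumes "n \<ge> 3"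
  shows "inj_on (\<lambda>i. {i, cyc_succ n i}) {1..n}"
  using assms by (auto simp: inj_on_def doubleton_eq_iff cyc_succ_def split: if_splits)

lemma in_cycle_edges_iff:
  assumes "n \<ge> 1"
  shows "{i, j} \<in> cycle_edges n \<longleftrightarrow>
    (i \<in> {1..n} \<and> j = cyc_succ n i) \<or> (j \<in> {1..n} \<and> i = cyc_succ n j)"
  unfolding cycle_edges_eq[OF assms] by (auto simp: image_iff doubleton_eq_iff)

text \<open>For \<open>n \<ge> 4\<close> the two neighbours of a vertex are not adjacent, so there
  is no triangle. Containment, rather than equality, also covers empty and one-element
  cliques.\<close>

lemma is_clique_cycle:
  assumes n: "n \<ge> 4" and K: "is_clique n (cycle_edges n) K"
  obtains i where "i \<in> {1..n}" "K \<subseteq> {i, cyc_succ n i}"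
proof (cases "K = {}")
  case True
  then show ?thesis using that[of 1] n by auto
next
  case False
  then obtain x where x: "x \<in> K" by auto
  have adj: "(i \<in> {1..n} \<and> j = cyc_succ n i) \<or> (j \<in> {1..n} \<and> i = cyc_succ n j)"
    if "i \<in> K" "j \<in> K" "i \<noteq> j" for i j
    using K that in_cycle_edges_iff[of n i j] n by (auto simp: is_clique_def)
  have x1: "x \<in> {1..n}" using K x by (auto simp: is_clique_def)
  show ?thesis
  proof (cases "K \<subseteq> {x, cyc_succ n x}")
    case True
    then show ?thesis using that x1 by blast
  next
    case False
    then obtain y where y: "y \<in> K" "y \<noteq> x" "y \<noteq> cyc_succ n x" by auto
    with adj[OF y(1) x] have y1: "y \<in> {1..n}" "x = cyc_succ n y" by auto
    have "K \<subseteq> {y, cyc_succ n y}"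
    proof
      fix z assume z: "z \<in> K"
      show "z \<in> {y, cyc_succ n y}"
        using adj[OF z x] adj[OF z y(1)] y y1 x1 n
        by (auto simp: cyc_succ_def split: if_splits)
    qed
    then show ?thesis using that y1 by blast
  qed
qed

lemma is_maximal_clique_cycle_edge:
  assumes n: "n \<ge> 4" and i: "i \<in> {1..n}"
  shows "is_maximal_clique n (cycle_edges n) {i, cyc_succ n i}"
  unfolding is_maximal_clique_def
proof (intro conjI allI impI)
  have "{i, cyc_succ n i} \<in> cycle_edges n" "{cyc_succ n i, i} \<in> cycle_edges n"
    using in_cycle_edges_iff[of n i "cyc_succ n i"] i n by (auto simp: insert_commute)
  then show "is_clique n (cycle_edges n) {i, cyc_succ n i}"
    using cyc_succ_in[OF i] i by (auto simp: is_clique_def)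
next
  fix K assume "is_clique n (cycle_edges n) K \<and> {i, cyc_succ n i} \<subseteq> K"
  moreover from this obtain j where j: "j \<in> {1..n}" "K \<subseteq> {j, cyc_succ n j}"
    using is_clique_cycle[OF n] by blast
  ultimately have "{i, cyc_succ n i} \<subseteq> K" "{i, cyc_succ n i} \<subseteq> {j, cyc_succ n j}" by auto
  with j cyc_succ_neq[of n i] n show "K = {i, cyc_succ n i}" by auto
qed

section \<open>Completing partial matrices on a cycle\<close>

text \<open>A test vector on \<open>K\<close> is extended by zero to \<open>L\<close>.\<close>

lemma psd_on_subset:
  assumes M: "psd_on L M" and "K \<subseteq> L" "finite L"
  shows "psd_on K M"
  unfolding psd_on_def
proof (intro conjI allI)
  show "\<forall>i\<in>K. \<forall>j\<in>K. M i j = M j i" using assms by (auto simp: psd_on_def)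
  fix x :: "nat \<Rightarrow> real"
  define y where "y = (\<lambda>i. if i \<in> K then x i else 0)"
  have "(\<Sum>i\<in>K. \<Sum>j\<in>K. x i * M i j * x j) = (\<Sum>i\<in>K. \<Sum>j\<in>K. y i * M i j * y j)"
    by (intro sum.cong) (auto simp: y_def)
  also have "\<dots> = (\<Sum>i\<in>K. \<Sum>j\<in>L. y i * M i j * y j)"
    using assms by (intro sum.cong sum.mono_neutral_left) (auto simp: y_def)
  also have "\<dots> = (\<Sum>i\<in>L. \<Sum>j\<in>L. y i * M i j * y j)"
    using assms by (intro sum.mono_neutral_left) (auto simp: y_def)
  also have "\<dots> \<ge> 0" using M by (auto simp: psd_on_def)
  finally show "0 \<le> (\<Sum>i\<in>K. \<Sum>j\<in>K. x i * M i j * x j)" .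
qed

text \<open>The determinant criterion for \<open>2 \<times> 2\<close> matrices. With the square root
  it reads as an interval for the off-diagonal entry, the side of a box in the volume
  estimate.\<close>

lemma psd_on_pair_iff:
  assumes "i \<noteq> j"
  shows "psd_on {i, j} M \<longleftrightarrow>
    M i j = M j i \<and> M i i \<ge> 0 \<and> M j j \<ge> 0 \<and> \<bar>M i j\<bar> \<le> sqrt (M i i * M j j)"
proof
  assume M: "psd_on {i, j} M"
  then have sym: "M i j = M j i" unfolding psd_on_def by blast
  have Q: "0 \<le> u * u * M i i + 2 * u * v * M i j + v * v * M j j" for u v
  proof -
    have "0 \<le> (\<Sum>k\<in>{i,j}. \<Sum>l\<in>{i,j}. ((\<lambda>_. v)(i := u)) k * M k l * ((\<lambda>_. v)(i := u)) l)"
      using M unfolding psd_on_def by blast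
    moreover have "M j i = M i j" using sym ..
    ultimately show ?thesis using assms by (simp add: algebra_simps)
  qed
  from Q[of 1 0] Q[of 0 1] have pos: "M i i \<ge> 0" "M j j \<ge> 0" by auto
  have "(M i j)\<^sup>2 \<le> M i i * M j j"
  proof (cases "M i i = 0")
    case True
    \<comment> \<open>With \<open>M i i = 0\<close> the form at \<open>v = 1\<close> is affine in
      \<open>u\<close>; the \<open>u\<close> chosen below gives it the value
      \<open>-1\<close>.\<close>
    have "M i j = 0"
    proof (rule ccontr)
      assume "M i j \<noteq> 0"
      then show False
        using Q[of "- (M j j + 1) / (2 * M i j)" 1] True by (simp add: field_simps)
    qed
    then show ?thesis using True by simp
  next
    case False
    \<comment> \<open>The vector \<open>(- M i j, M i i)\<close> minimises the form up to scaling
      and yields \<open>M i i\<close> times the determinant.\<close>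
    have "0 \<le> M i i * (M i i * M j j - (M i j)\<^sup>2)"
      using Q[of "- M i j" "M i i"] by (simp add: algebra_simps power2_eq_square)
    then show ?thesis using False pos by (simp add: zero_le_mult_iff)
  qed
  then have "\<bar>M i j\<bar> \<le> sqrt (M i i * M j j)"
    by (metis power2_abs real_le_rsqrt)
  with pos sym show "M i j = M j i \<and> M i i \<ge> 0 \<and> M j j \<ge> 0 \<and> \<bar>M i j\<bar> \<le> sqrt (M i i * M j j)"
    by simp
next
  assume "M i j = M j i \<and> M i i \<ge> 0 \<and> M j j \<ge> 0 \<and> \<bar>M i j\<bar> \<le> sqrt (M i i * M j j)"
  then have sym: "M j i = M i j" and pos: "M i i \<ge> 0" "M j j \<ge> 0"
    and le: "\<bar>M i j\<bar> \<le> sqrt (M i i * M j j)" by auto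
  show "psd_on {i, j} M"
    unfolding psd_on_def
  proof (intro conjI allI)
    show "\<forall>k\<in>{i, j}. \<forall>l\<in>{i, j}. M k l = M l k" using sym by auto
    fix x :: "nat \<Rightarrow> real"
    \<comment> \<open>Rescaling by the square roots of the diagonal reduces the claim to
      \<open>2 * \<bar>u * v\<bar> \<le> u * u + v * v\<close>.\<close>
    define u v where "u = sqrt (M i i) * x i" and "v = sqrt (M j j) * x j"
    have "\<bar>M i j * (x i * x j)\<bar> \<le> sqrt (M i i * M j j) * \<bar>x i * x j\<bar>"
      unfolding abs_mult using le by (intro mult_right_mono) auto
    also have "\<dots> = \<bar>u * v\<bar>"
      using pos by (simp add: u_def v_def abs_mult real_sqrt_mult)
    finally have 1: "\<bar>M i j * (x i * x j)\<bar> \<le> \<bar>u * v\<bar>" .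
    have 2: "2 * \<bar>u * v\<bar> \<le> u * u + v * v"
      using sum_squares_bound[of "\<bar>u\<bar>" "\<bar>v\<bar>"] by (simp add: power2_eq_square abs_mult)
    have 3: "u * u = x i * M i i * x i" "v * v = x j * M j j * x j"
      using pos by (simp_all add: u_def v_def)
    have "(\<Sum>k\<in>{i,j}. \<Sum>l\<in>{i,j}. x k * M k l * x l)
        = x i * M i i * x i + x j * M j j * x j + 2 * (M i j * (x i * x j))"
      using assms sym by (simp add: algebra_simps)
    then show "0 \<le> (\<Sum>k\<in>{i,j}. \<Sum>l\<in>{i,j}. x k * M k l * x l)"
      using 1 2 3 by linarith
  qed
qed

section \<open>Completable edge correlations\<close>

text \<open>The projection of the elliptope, the set of correlation matrices, to the edges of the
  cycle.\<close>

definition cycle_correlation :: "nat \<Rightarrow> (nat \<Rightarrow> real) \<Rightarrow> bool" where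
  "cycle_correlation n t \<longleftrightarrow> (\<exists>M. psd_on {1..n} M \<and> (\<forall>i\<in>{1..n}. M i i = 1) \<and>
     (\<forall>i\<in>{1..n}. M i (cyc_succ n i) = t i))"

text \<open>The elliptope is convex and the projection to the edge entries is linear.\<close>

lemma cycle_correlation_convex:
  assumes "cycle_correlation n t" "cycle_correlation n t'" "0 \<le> c" "c \<le> 1"
  shows "cycle_correlation n (\<lambda>i. c * t i + (1 - c) * t' i)"
proof -
  obtain M where M: "psd_on {1..n} M" "\<forall>i\<in>{1..n}. M i i = 1"
     "\<forall>i\<in>{1..n}. M i (cyc_succ n i) = t i" using assms by (auto simp: cycle_correlation_def)
  obtain M' where M': "psd_on {1..n} M'" "\<forall>i\<in>{1..n}. M' i i = 1"
     "\<forall>i\<in>{1..n}. M' i (cyc_succ n i) = t' i" using assms by (auto simp: cycle_correlation_def)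
  have "psd_on {1..n} (\<lambda>i j. c * M i j + (1 - c) * M' i j)"
    unfolding psd_on_def
  proof (intro conjI allI)
    show "\<forall>i\<in>{1..n}. \<forall>j\<in>{1..n}. c * M i j + (1 - c) * M' i j = c * M j i + (1 - c) * M' j i"
      using M M' by (auto simp: psd_on_def)
    fix x :: "nat \<Rightarrow> real"
    have "(\<Sum>i=1..n. \<Sum>j=1..n. x i * (c * M i j + (1 - c) * M' i j) * x j) =
      c * (\<Sum>i=1..n. \<Sum>j=1..n. x i * M i j * x j) + (1 - c) * (\<Sum>i=1..n. \<Sum>j=1..n. x i * M' i j * x j)"
      unfolding sum_distrib_left sum.distrib[symmetric] by (intro sum.cong) (auto simp: algebra_simps)
    also have "\<dots> \<ge> 0"
      using M M' assms by (intro add_nonneg_nonneg mult_nonneg_nonneg) (auto simp: psd_on_def)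
    finally show "0 \<le> (\<Sum>i=1..n. \<Sum>j=1..n. x i * (c * M i j + (1 - c) * M' i j) * x j)" .
  qed
  then show ?thesis
    using M M' unfolding cycle_correlation_def
    by (intro exI[of _ "\<lambda>i j. c * M i j + (1 - c) * M' i j"]) auto
qed

text \<open>
  If all correlations except those of the edges \<open>p\<close>, \<open>q\<close>, \<open>r\<close> are \<open>\<plusminus>1\<close>, then up to signs the vertices fall
  into three classes \<open>\<rho> = 0, 1, 2\<close> of equal vectors, and it suffices to realise the diagonally
  dominant \<open>3 \<times> 3\<close> matrix \<open>B\<close>. The sign \<open>u r\<close> makes the signs consistent around the cycle.
\<close>

lemma cycle_correlation_corner:
  assumes ord: "1 \<le> p" "p < q" "q < r" "r \<le> n"
    and sgn: "\<And>i. i \<in> {1..n} - {p, q, r} \<Longrightarrow> t i \<in> {1, -1}"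
    and small: "\<And>i. i \<in> {p, q, r} \<Longrightarrow> \<bar>t i\<bar> \<le> 1/2"
  shows "cycle_correlation n t"
proof -
  define u where "u = (\<lambda>i. if i \<in> {p, q} then 1 else
    if i = r then (\<Prod>j\<in>{1..n} - {p, q, r}. t j) else t i)"
  have prod_pm: "(\<Prod>j\<in>S. f j) \<in> {1, -1}" if "\<And>i. i \<in> S \<Longrightarrow> f i \<in> {1, -1}" for S and f :: "nat \<Rightarrow> real"
    using that
  proof (induction S rule: infinite_finite_induct)
    case (insert x F)
    then have "f x \<in> {1, -1}" "prod f F \<in> {1, -1}" by blast+
    then show ?case using insert.hyps by auto
  qed auto
  have u_pm: "u i \<in> {1, -1}" if "i \<in> {1..n}" for i
    using that sgn prod_pm[of "{1..n} - {p, q, r}" t] unfolding u_def by auto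
  have "(\<Prod>j\<in>{1..n}. u j) = (\<Prod>j\<in>{p, q, r}. u j) * (\<Prod>j\<in>{1..n} - {p, q, r}. u j)"
    using ord by (subst prod.subset_diff[of "{p, q, r}"]) auto
  also have "(\<Prod>j\<in>{1..n} - {p, q, r}. u j) = (\<Prod>j\<in>{1..n} - {p, q, r}. t j)"
    by (intro prod.cong) (auto simp: u_def)
  also have "(\<Prod>j\<in>{p, q, r}. u j) = (\<Prod>j\<in>{1..n} - {p, q, r}. t j)"
    using ord by (auto simp: u_def)
  finally have u1: "(\<Prod>j\<in>{1..n}. u j) = 1"
    using prod_pm[of "{1..n} - {p, q, r}" t] sgn by auto
  \<comment> \<open>The sign of a vertex is the product of the edge signs \<open>u\<close> on the
    path from \<open>1\<close>. By \<open>u1\<close> the rule also holds on the closing edge from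
    \<open>n\<close> to \<open>1\<close>.\<close>
  define s where "s i = (\<Prod>j\<in>{1..<i}. u j)" for i
  have s_pm: "s i \<in> {1, -1}" if "i \<in> {1..n}" for i
    unfolding s_def using that by (intro prod_pm u_pm) auto
  have s_succ: "s i * s (cyc_succ n i) = u i" if i: "i \<in> {1..n}" for i
  proof -
    have "s (Suc i) = s i * u i" using i by (simp add: s_def)
    moreover have "s 1 = 1" by (simp add: s_def)
    moreover have "s (Suc n) = 1" using u1 by (simp add: s_def atLeastLessThanSuc_atLeastAtMost)
    ultimately have "s (cyc_succ n i) = s i * u i" by (auto simp: cyc_succ_def)
    then show ?thesis using s_pm[OF i] by auto
  qed
  \<comment> \<open>Cutting the edges \<open>p\<close>, \<open>q\<close>, \<open>r\<close> leaves
    three arcs; class \<open>0\<close> is the arc through \<open>1\<close>, which may pass through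
    \<open>n\<close>.\<close>
  define \<rho> :: "nat \<Rightarrow> nat" where "\<rho> i = (if i \<le> p \<or> i > r then 0 else if i \<le> q then 1 else 2)" for i
  \<comment> \<open>The two ends of edge \<open>r\<close> have signs with product
    \<open>u r\<close>, and the factor \<open>u r\<close> in \<open>c\<close> cancels it. For
    \<open>p\<close> and \<open>q\<close> this product is \<open>1\<close>.\<close>
  define a b c where "a = t p" and "b = t q" and "c = u r * t r"
  have abc: "\<bar>a\<bar> \<le> 1/2" "\<bar>b\<bar> \<le> 1/2" "\<bar>c\<bar> \<le> 1/2"
    using small u_pm[of r] ord by (auto simp: a_def b_def c_def)
  \<comment> \<open>Off the diagonal \<open>k + l\<close> identifies the pair of classes:
    \<open>1\<close> for \<open>{0, 1}\<close>, \<open>3\<close> for \<open>{1, 2}\<close>,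
    \<open>2\<close> for \<open>{0, 2}\<close>.\<close>
  define B :: "nat \<Rightarrow> nat \<Rightarrow> real" where "B k l = (if k = l then 1 else
    if k + l = 1 then a else if k + l = 3 then b else c)" for k l
  define M where "M i j = s i * s j * B (\<rho> i) (\<rho> j)" for i j
  have "psd_on {1..n} M"
    unfolding psd_on_def
  proof (intro conjI allI)
    show "\<forall>i\<in>{1..n}. \<forall>j\<in>{1..n}. M i j = M j i" by (auto simp: M_def B_def add.commute)
    fix x :: "nat \<Rightarrow> real"
    \<comment> \<open>Adding up the signed coordinates in each class turns the form of
      \<open>M\<close> at \<open>x\<close> into the form of \<open>B\<close> at
      \<open>D\<close>.\<close>
    define d where "d k i = (if \<rho> i = k then s i * x i else 0)" for k i
    define D where "D k = (\<Sum>i=1..n. d k i)" for k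
    have DD: "(\<Sum>i=1..n. \<Sum>j=1..n. e * (d k i * d l j)) = e * (D k * D l)" for e k l
      by (simp only: D_def sum_product) (simp only: sum_distrib_left)
    have "x i * M i j * x j = 1 * (d 0 i * d 0 j) + 1 * (d 1 i * d 1 j) + 1 * (d 2 i * d 2 j)
        + a * (d 0 i * d 1 j) + a * (d 1 i * d 0 j) + b * (d 1 i * d 2 j) + b * (d 2 i * d 1 j)
        + c * (d 0 i * d 2 j) + c * (d 2 i * d 0 j)" for i j
      by (auto simp: M_def d_def B_def \<rho>_def)
    then have "(\<Sum>i=1..n. \<Sum>j=1..n. x i * M i j * x j) =
        D 0 * D 0 + D 1 * D 1 + D 2 * D 2
        + 2 * (a * (D 0 * D 1)) + 2 * (b * (D 1 * D 2)) + 2 * (c * (D 0 * D 2))"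
      by (simp only: sum.distrib DD) simp
    \<comment> \<open>Here the constant \<open>1/2\<close> matters: twice a cross term is at most
      half the sum of its two squares, and each square occurs in two of the three pairs.\<close>
    moreover have le: "\<bar>e * (f * g)\<bar> \<le> (f * f + g * g) / 4" if "\<bar>e\<bar> \<le> 1/2" for e f g :: real
    proof -
      have "\<bar>e * (f * g)\<bar> \<le> 1/2 * \<bar>f * g\<bar>"
        unfolding abs_mult[of e] using that by (intro mult_right_mono) auto
      also have "\<dots> \<le> 1/2 * ((f * f + g * g) / 2)"
        using sum_squares_bound[of "\<bar>f\<bar>" "\<bar>g\<bar>"] by (simp add: power2_eq_square abs_mult)
      finally show ?thesis by simp
    qed
    ultimately show "0 \<le> (\<Sum>i=1..n. \<Sum>j=1..n. x i * M i j * x j)"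
      using le[OF abc(1), of "D 0" "D 1"] le[OF abc(2), of "D 1" "D 2"]
        le[OF abc(3), of "D 0" "D 2"]
      unfolding abs_le_iff add_divide_distrib by linarith
  qed
  moreover have "M i i = 1" if "i \<in> {1..n}" for i
    using s_pm[OF that] by (auto simp: M_def B_def)
  moreover have "M i (cyc_succ n i) = t i" if i: "i \<in> {1..n}" for i
  proof -
    have "M i (cyc_succ n i) = u i * B (\<rho> i) (\<rho> (cyc_succ n i))"
      using s_succ[OF i] by (simp add: M_def)
    moreover have "u r * u r = 1" using u_pm[of r] ord by auto
    moreover consider "i = p" | "i = q" | "i = r" | "i \<notin> {p, q, r}" by blast
    then have "u i * B (\<rho> i) (\<rho> (cyc_succ n i)) = t i"
    proof cases
      case 1
      then have "\<rho> i = 0" "\<rho> (cyc_succ n i) = 1"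
        using ord by (auto simp: \<rho>_def cyc_succ_def)
      then show ?thesis using 1 by (simp add: B_def u_def a_def)
    next
      case 2
      then have "\<rho> i = 1" "\<rho> (cyc_succ n i) = 2"
        using ord by (auto simp: \<rho>_def cyc_succ_def)
      then show ?thesis using 2 by (simp add: B_def u_def b_def)
    next
      case 3
      then have "\<rho> i = 2" "\<rho> (cyc_succ n i) = 0"
        using ord by (auto simp: \<rho>_def cyc_succ_def)
      then show ?thesis using 3 \<open>u r * u r = 1\<close>
        by (simp add: B_def c_def mult.assoc[symmetric])
    next
      case 4
      then have "\<rho> (cyc_succ n i) = \<rho> i"
        using ord i by (auto simp: \<rho>_def cyc_succ_def)
      then show ?thesis using 4 by (simp add: B_def u_def)
    qed
    ultimately show ?thesis by simp
  qed
  ultimately show ?thesis by (auto simp: cycle_correlation_def)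
qed

text \<open>With the coordinates \<open>p\<close>, \<open>q\<close>, \<open>r\<close> kept fixed,
  \<open>t\<close> is a convex combination of vectors whose other coordinates are \<open>1\<close>
  or \<open>-1\<close>, and these are completable by
  \<open>cycle_correlation_corner\<close>.\<close>

lemma cycle_correlation_three_small:
  assumes ord: "1 \<le> p" "p < q" "q < r" "r \<le> n"
    and le: "\<And>i. i \<in> {1..n} \<Longrightarrow> \<bar>t i\<bar> \<le> 1"
    and small: "\<And>i. i \<in> {p, q, r} \<Longrightarrow> \<bar>t i\<bar> \<le> 1/2"
  shows "cycle_correlation n t"
proof -
  \<comment> \<open>By convexity, each coordinate in \<open>F\<close> may be moved to \<open>1\<close> and \<open>-1\<close>.\<close>
  have "cycle_correlation n t"
    if "finite F" "\<And>i. i \<in> {1..n} \<Longrightarrow> \<bar>t i\<bar> \<le> 1" "\<And>i. i \<in> {p, q, r} \<Longrightarrow> \<bar>t i\<bar> \<le> 1/2"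
      "\<And>i. i \<in> {1..n} - {p, q, r} - F \<Longrightarrow> t i \<in> {1, -1}" for F t
    using that
  proof (induction F arbitrary: t rule: finite_induct)
    case empty
    then show ?case by (intro cycle_correlation_corner[OF ord]) auto
  next
    case (insert k F)
    show ?case
    proof (cases "k \<in> {1..n} - {p, q, r}")
      case False
      then show ?thesis using insert.prems by (intro insert.IH) auto
    next
      case True
      have upd: "cycle_correlation n (t(k := e))" if "e \<in> {1, -1}" for e
        using insert.prems True that by (intro insert.IH) auto
      \<comment> \<open>The weight for which \<open>t k = c * 1 + (1 - c) * (-1)\<close>.\<close>
      define c where "c = (1 + t k) / 2"
      have "\<bar>t k\<bar> \<le> 1" using insert.prems True by auto
      then have "cycle_correlation n (\<lambda>i. c * (t(k := 1)) i + (1 - c) * (t(k := -1)) i)"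
        by (intro cycle_correlation_convex upd) (auto simp: c_def)
      also have "(\<lambda>i. c * (t(k := 1)) i + (1 - c) * (t(k := -1)) i) = t"
        by (auto simp: c_def algebra_simps add_divide_distrib)
      finally show ?thesis .
    qed
  qed
  from this[of "{1..n}" t] show ?thesis using le small by auto
qed

section \<open>Membership in \<open>PG\<close> and \<open>SigmaG\<close> for the cycle\<close>

lemma psd_on_cong:
  assumes "\<And>i j. i \<in> K \<Longrightarrow> j \<in> K \<Longrightarrow> M i j = M' i j"
  shows "psd_on K M \<longleftrightarrow> psd_on K M'"
proof -
  have "(\<Sum>i\<in>K. \<Sum>j\<in>K. x i * M i j * x j) = (\<Sum>i\<in>K. \<Sum>j\<in>K. x i * M' i j * x j)" for x
    using assms by (intro sum.cong) auto
  then show ?thesis using assms unfolding psd_on_def by simp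
qed

lemma entry_edge: "n \<ge> 2 \<Longrightarrow> entry A i (cyc_succ n i) = A (Inr {i, cyc_succ n i})"
  using cyc_succ_neq[of n i] by (simp add: entry_def)

text \<open>Every clique lies in an edge and principal submatrices inherit positive
  semidefiniteness, so only the \<open>2 \<times> 2\<close> conditions of the edges count.\<close>

lemma in_PG_cycle_iff:
  assumes n: "n \<ge> 4"
  shows "A \<in> PG n (cycle_edges n) \<longleftrightarrow> A \<in> Sym n (cycle_edges n) \<and>
    (\<forall>i\<in>{1..n}. A (Inl i) \<ge> 0 \<and>
      \<bar>A (Inr {i, cyc_succ n i})\<bar> \<le> sqrt (A (Inl i) * A (Inl (cyc_succ n i))))"
proof -
  have edge: "psd_on {i, cyc_succ n i} (entry A) \<longleftrightarrow> A (Inl i) \<ge> 0 \<and> A (Inl (cyc_succ n i)) \<ge> 0 \<and>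
      \<bar>A (Inr {i, cyc_succ n i})\<bar> \<le> sqrt (A (Inl i) * A (Inl (cyc_succ n i)))" for i
    using cyc_succ_neq[of n i] n
    by (subst psd_on_pair_iff) (auto simp: entry_def insert_commute)
  have "(\<forall>K. is_maximal_clique n (cycle_edges n) K \<longrightarrow> psd_on K (entry A)) \<longleftrightarrow>
      (\<forall>i\<in>{1..n}. psd_on {i, cyc_succ n i} (entry A))"
  proof (intro iffI allI impI ballI)
    fix K assume *: "\<forall>i\<in>{1..n}. psd_on {i, cyc_succ n i} (entry A)"
      and "is_maximal_clique n (cycle_edges n) K"
    then have "is_clique n (cycle_edges n) K" by (simp add: is_maximal_clique_def)
    then obtain i where i: "i \<in> {1..n}" "K \<subseteq> {i, cyc_succ n i}"
      using is_clique_cycle[OF n] by blast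
    show "psd_on K (entry A)"
      by (rule psd_on_subset[OF bspec[OF * i(1)] i(2)]) simp
  qed (use is_maximal_clique_cycle_edge[OF n] in blast)
  also have "\<dots> \<longleftrightarrow> (\<forall>i\<in>{1..n}. A (Inl i) \<ge> 0 \<and>
      \<bar>A (Inr {i, cyc_succ n i})\<bar> \<le> sqrt (A (Inl i) * A (Inl (cyc_succ n i))))"
    unfolding edge using cyc_succ_in[of _ n] by blast
  finally show ?thesis unfolding PG_def by blast
qed

text \<open>On a clique all entries are specified, so the submatrix of \<open>A\<close> is a
  principal submatrix of each completion.\<close>

lemma SigmaG_subset_PG: "SigmaG n E \<subseteq> PG n E"
proof
  fix A assume "A \<in> SigmaG n E"
  then obtain M where A: "A \<in> Sym n E" and M: "psd_on {1..n} M"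
    and eq: "\<And>i j. i \<in> {1..n} \<Longrightarrow> j \<in> {1..n} \<Longrightarrow> i = j \<or> {i, j} \<in> E \<Longrightarrow> M i j = entry A i j"
    unfolding SigmaG_def by blast
  have "psd_on K (entry A)" if "is_maximal_clique n E K" for K
  proof -
    have K: "K \<subseteq> {1..n}" "\<And>i j. i \<in> K \<Longrightarrow> j \<in> K \<Longrightarrow> i = j \<or> {i, j} \<in> E"
      using that by (auto simp: is_maximal_clique_def is_clique_def)
    have "psd_on K M" using psd_on_subset[OF M K(1)] by simp
    moreover have "M i j = entry A i j" if "i \<in> K" "j \<in> K" for i j
      using K that by (intro eq) auto
    ultimately show ?thesis using psd_on_cong by metis
  qed
  then show "A \<in> PG n E" using A by (simp add: PG_def)
qed

text \<open>Each edge is read in one orientation; the symmetry of \<open>M\<close> supplies the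
  other.\<close>

lemma in_SigmaG_cycle_iff:
  assumes n: "n \<ge> 3"
  shows "A \<in> SigmaG n (cycle_edges n) \<longleftrightarrow> A \<in> Sym n (cycle_edges n) \<and>
    (\<exists>M. psd_on {1..n} M \<and>
      (\<forall>i\<in>{1..n}. M i i = A (Inl i) \<and> M i (cyc_succ n i) = A (Inr {i, cyc_succ n i})))"
proof -
  have "(\<forall>i\<in>{1..n}. \<forall>j\<in>{1..n}. i = j \<or> {i, j} \<in> cycle_edges n \<longrightarrow> M i j = entry A i j) \<longleftrightarrow>
    (\<forall>i\<in>{1..n}. M i i = A (Inl i) \<and> M i (cyc_succ n i) = A (Inr {i, cyc_succ n i}))"
    (is "?L \<longleftrightarrow> ?R") if M: "psd_on {1..n} M" for M
  proof
    assume L: ?L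
    show ?R
    proof
      fix i assume i: "i \<in> {1..n}"
      have "{i, cyc_succ n i} \<in> cycle_edges n"
        using i n in_cycle_edges_iff[of n i "cyc_succ n i"] by simp
      with L i cyc_succ_in[OF i] have "M i (cyc_succ n i) = entry A i (cyc_succ n i)" by blast
      moreover from L i have "M i i = entry A i i" by blast
      ultimately show "M i i = A (Inl i) \<and> M i (cyc_succ n i) = A (Inr {i, cyc_succ n i})"
        using n by (simp add: entry_edge entry_def[of _ i i])
    qed
  next
    assume R: ?R
    show ?L
    proof (intro ballI impI)
      fix i j assume i: "i \<in> {1..n}" and j: "j \<in> {1..n}" and ij: "i = j \<or> {i, j} \<in> cycle_edges n"
      have sym: "M i j = M j i" using M i j unfolding psd_on_def by blast
      have "entry A j i = entry A i j" by (auto simp: entry_def insert_commute)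
      moreover from ij consider "i = j" | "j = cyc_succ n i" | "i = cyc_succ n j"
        using in_cycle_edges_iff[of n i j] n by auto
      then have "M i j = entry A i j \<or> M j i = entry A j i"
        using R i j entry_edge[of n A] n by cases (auto simp: entry_def)
      ultimately show "M i j = entry A i j" using sym by simp
    qed
  qed
  then show ?thesis unfolding SigmaG_def by blast
qed

text \<open>Scaling rows and columns by the square roots \<open>d\<close> of the diagonal preserves
  positive semidefiniteness, so it suffices to complete the correlations \<open>t\<close>.\<close>

lemma in_SigmaG_cycle_if_three_small:
  assumes n: "n \<ge> 4" and A: "A \<in> PG n (cycle_edges n)"
    and ord: "1 \<le> p" "p < q" "q < r" "r \<le> n"
    and small: "\<And>i. i \<in> {p, q, r} \<Longrightarrow>
      \<bar>A (Inr {i, cyc_succ n i})\<bar> \<le> sqrt (A (Inl i) * A (Inl (cyc_succ n i))) / 2"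
  shows "A \<in> SigmaG n (cycle_edges n)"
proof -
  define d where "d i = sqrt (A (Inl i))" for i
  define e where "e i = A (Inr {i, cyc_succ n i})" for i
  \<comment> \<open>If the denominator vanishes, so does \<open>e i\<close>, and \<open>t i = 0\<close> is then as good as any value.\<close>
  define t where "t i = e i / (d i * d (cyc_succ n i))" for i
  have d: "d i \<ge> 0" "d i * d i = A (Inl i)"
    and e: "\<bar>e i\<bar> \<le> d i * d (cyc_succ n i)" if "i \<in> {1..n}" for i
    using A that unfolding in_PG_cycle_iff[OF n] d_def e_def by (auto simp: real_sqrt_mult)
  have d2: "d i * d (cyc_succ n i) \<ge> 0" if "i \<in> {1..n}" for i
    using d cyc_succ_in that by simp
  have small': "\<bar>e i\<bar> \<le> d i * d (cyc_succ n i) / 2" if "i \<in> {p, q, r}" for i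
    using small[OF that] by (simp add: d_def e_def real_sqrt_mult)
  have et: "t i * (d i * d (cyc_succ n i)) = e i" if "i \<in> {1..n}" for i
    using e[OF that] by (auto simp: t_def)
  have "cycle_correlation n t"
  proof (rule cycle_correlation_three_small[OF ord])
    show "\<bar>t i\<bar> \<le> 1" if "i \<in> {1..n}" for i
      using e[OF that] d2[OF that] by (auto simp: t_def abs_mult divide_le_eq_1)
    show "\<bar>t i\<bar> \<le> 1/2" if "i \<in> {p, q, r}" for i
    proof -
      have "i \<in> {1..n}" using ord that by auto
      then have "d i * d (cyc_succ n i) \<ge> 0" by (rule d2)
      moreover from this have "\<bar>t i\<bar> = \<bar>e i\<bar> / (d i * d (cyc_succ n i))"
        unfolding t_def abs_divide by (simp only: abs_of_nonneg)
      ultimately show ?thesis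
        using small'[OF that] by (cases "d i * d (cyc_succ n i) = 0") (simp_all add: divide_le_eq)
    qed
  qed
  then obtain M where M: "psd_on {1..n} M" "\<forall>i\<in>{1..n}. M i i = 1"
    "\<forall>i\<in>{1..n}. M i (cyc_succ n i) = t i" unfolding cycle_correlation_def by blast
  define M' where "M' i j = d i * M i j * d j" for i j
  have "psd_on {1..n} M'"
    unfolding psd_on_def
  proof (intro conjI allI ballI)
    fix i j assume "i \<in> {1..n}" "j \<in> {1..n}"
    then show "M' i j = M' j i" using M(1) unfolding psd_on_def M'_def by simp
  next
    fix x :: "nat \<Rightarrow> real"
    have "0 \<le> (\<Sum>i=1..n. \<Sum>j=1..n. (x i * d i) * M i j * (x j * d j))"
      using M(1) unfolding psd_on_def by (elim conjE allE[of _ "\<lambda>i. x i * d i"])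
    then show "0 \<le> (\<Sum>i=1..n. \<Sum>j=1..n. x i * M' i j * x j)"
      by (simp add: M'_def mult_ac)
  qed
  moreover have "M' i i = A (Inl i)" "M' i (cyc_succ n i) = e i" if "i \<in> {1..n}" for i
    using M(2,3) that d(2) et[OF that] by (auto simp: M'_def mult_ac)
  ultimately show ?thesis
    using A n unfolding in_SigmaG_cycle_iff[OF order.trans[OF _ n, of 3, simplified]] e_def
    by (auto simp: PG_def)
qed

section \<open>Measurability\<close>

text \<open>
  \<open>Sigma_bar\<close> is a projection of the set of PSD matrices of trace one, hence compact. To apply this in
  the product topology, whose Borel sets are known to be generated by the coordinates only for
  countable index types, the edge \<open>{i, cyc_succ n i}\<close> is indexed by \<open>Inr i\<close>.
\<close>

definition cycle_data :: "nat \<Rightarrow> pmat \<Rightarrow> nat + nat \<Rightarrow> real" where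
  "cycle_data n A k = (case k of
     Inl i \<Rightarrow> if i \<in> {1..n} then A (Inl i) else 0
   | Inr i \<Rightarrow> if i \<in> {1..n} then A (Inr {i, cyc_succ n i}) else 0)"

text \<open>The coordinates of \<open>cycle_data\<close>, read off a full matrix. As both vanish
  outside \<open>{1..n}\<close>, equality of the two concerns exactly the specified entries.\<close>

definition matrix_data :: "nat \<Rightarrow> (nat \<times> nat \<Rightarrow> real) \<Rightarrow> nat + nat \<Rightarrow> real" where
  "matrix_data n M k = (case k of
     Inl i \<Rightarrow> if i \<in> {1..n} then M (i, i) else 0
   | Inr i \<Rightarrow> if i \<in> {1..n} then M (i, cyc_succ n i) else 0)"

text \<open>The bound on all entries confines those outside \<open>{1..n}\<close>, which is needed for compactness.\<close>

definition psd_trace_one :: "nat \<Rightarrow> (nat \<times> nat \<Rightarrow> real) set" where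
  "psd_trace_one n = {M. (\<forall>k. \<bar>M k\<bar> \<le> 1) \<and> psd_on {1..n} (\<lambda>i j. M (i, j)) \<and> (\<Sum>i=1..n. M (i, i)) = 1}"

text \<open>A closed subset of a product of intervals \<open>{-1..1}\<close>, which is compact by
  Tychonoff's theorem.\<close>

lemma compact_psd_trace_one: "compact (psd_trace_one n)"
proof -
  have "compact (Pi\<^sub>E UNIV (\<lambda>_. {-1..1}) :: (nat \<times> nat \<Rightarrow> real) set)"
  proof -
    have "compactin (product_topology (\<lambda>_. euclidean) UNIV) (Pi\<^sub>E UNIV (\<lambda>_. {-1..1}) :: (nat \<times> nat \<Rightarrow> real) set)"
      unfolding compactin_PiE by auto
    then show ?thesis by (simp add: euclidean_product_topology)
  qed
  moreover have "closed {M :: nat \<times> nat \<Rightarrow> real. psd_on {1..n} (\<lambda>i j. M (i, j)) \<and> (\<Sum>i=1..n. M (i, i)) = 1}"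
    \<comment> \<open>Membership of an index in \<open>{1..n}\<close> does not depend on
      \<open>M\<close>: the bounded quantifiers become implications whose premise is constant, hence
      an open condition.\<close>
    unfolding psd_on_def Ball_def
    by (intro closed_Collect_conj closed_Collect_all closed_Collect_imp closed_Collect_eq
        closed_Collect_le open_Collect_const continuous_intros continuous_on_product_coordinates)
  moreover have "psd_trace_one n = Pi\<^sub>E UNIV (\<lambda>_. {-1..1}) \<inter>
      {M. psd_on {1..n} (\<lambda>i j. M (i, j)) \<and> (\<Sum>i=1..n. M (i, i)) = 1}"
    by (auto simp: psd_trace_one_def PiE_iff abs_le_iff minus_le_iff)
  ultimately show ?thesis by (simp only: compact_Int_closed)
qed

lemma compact_matrix_data_image: "compact (matrix_data n ` psd_trace_one n)"
proof (rule compact_continuous_image[OF _ compact_psd_trace_one])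
  have "continuous_on (psd_trace_one n) (\<lambda>M. matrix_data n M k)" for k
  proof (cases k)
    case (Inl i)
    then show ?thesis
      by (cases "i \<in> {1..n}")
        (simp_all add: matrix_data_def continuous_on_subset[OF continuous_on_product_coordinates]
          del: atLeastAtMost_iff)
  next
    case (Inr i)
    then show ?thesis
      by (cases "i \<in> {1..n}")
        (simp_all add: matrix_data_def continuous_on_subset[OF continuous_on_product_coordinates]
          del: atLeastAtMost_iff)
  qed
  then show "continuous_on (psd_trace_one n) (matrix_data n)"
    by (intro continuous_on_coordinatewise_then_product) auto
qed

lemma psd_on_diag_nonneg:
  assumes "psd_on K M" "finite K" "i \<in> K"
  shows "M i i \<ge> 0"
proof -
  have "psd_on {i} M" using psd_on_subset[of K M "{i}"] assms by simp
  then have "\<forall>x::nat \<Rightarrow> real. 0 \<le> x i * M i i * x i" by (simp add: psd_on_def)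
  from spec[OF this, of "\<lambda>_. 1"] show ?thesis by simp
qed

text \<open>The \<open>2 \<times> 2\<close> minors bound an entry by the geometric mean of two
  diagonal entries. This gives the bound in \<open>psd_trace_one\<close> for completions of trace
  one.\<close>

lemma psd_on_abs_le:
  assumes "psd_on K M" "finite K" "i \<in> K" "j \<in> K" "M i i \<le> 1" "M j j \<le> 1"
  shows "\<bar>M i j\<bar> \<le> 1"
proof (cases "i = j")
  case True
  then show ?thesis using psd_on_diag_nonneg[OF assms(1-3)] assms by simp
next
  case False
  have "psd_on {i, j} M" using psd_on_subset[of K M "{i, j}"] assms by simp
  then have "\<bar>M i j\<bar> \<le> sqrt (M i i * M j j)" "M i i \<ge> 0" "M j j \<ge> 0"
    using psd_on_pair_iff[OF False] by auto
  moreover from this have "sqrt (M i i * M j j) \<le> 1" using assms by (simp add: mult_le_one)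
  ultimately show ?thesis by linarith
qed

text \<open>Presents \<open>Sigma_bar\<close> as the preimage of a compact set under a coordinate
  map, from which measurability follows.\<close>

lemma Sigma_bar_cycle_eq:
  assumes n: "n \<ge> 3"
  shows "Sigma_bar n (cycle_edges n) =
    {A \<in> Sym n (cycle_edges n). cycle_data n A \<in> matrix_data n ` psd_trace_one n}"
proof (intro equalityI subsetI)
  fix A assume "A \<in> Sigma_bar n (cycle_edges n)"
  then obtain M where A: "A \<in> Sym n (cycle_edges n)" and tr: "tr n A = 1" and M: "psd_on {1..n} M"
    and eq: "\<forall>i\<in>{1..n}. M i i = A (Inl i) \<and> M i (cyc_succ n i) = A (Inr {i, cyc_succ n i})"
    unfolding Sigma_bar_def trace_hyperplane_def using in_SigmaG_cycle_iff[OF n] by auto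
  have sum1: "(\<Sum>i=1..n. M i i) = 1"
    using tr eq by (simp add: tr_def entry_def)
  \<comment> \<open>A completion is arbitrary outside \<open>{1..n}\<close>; replacing it by zero
    there meets the bound on all entries.\<close>
  define N where "N = (\<lambda>(i, j). if i \<in> {1..n} \<and> j \<in> {1..n} then M i j else 0)"
  have diag: "M i i \<le> 1" if "i \<in> {1..n}" for i
    using member_le_sum[of i "{1..n}" "\<lambda>i. M i i"] that psd_on_diag_nonneg[OF M] sum1 by auto
  have "N \<in> psd_trace_one n"
    unfolding psd_trace_one_def
  proof (intro CollectI conjI allI)
    show "\<bar>N k\<bar> \<le> 1" for k
      using psd_on_abs_le[OF M, of "fst k" "snd k"] diag by (cases k) (auto simp: N_def)
    show "psd_on {1..n} (\<lambda>i j. N (i, j))"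
      using M by (subst psd_on_cong[where M' = M]) (auto simp: N_def)
    have "(\<Sum>i=1..n. N (i, i)) = (\<Sum>i=1..n. M i i)" by (intro sum.cong) (auto simp: N_def)
    then show "(\<Sum>i=1..n. N (i, i)) = 1" using sum1 by simp
  qed
  moreover have "cycle_data n A = matrix_data n N"
    using eq cyc_succ_in[of _ n]
    by (auto simp: cycle_data_def matrix_data_def N_def fun_eq_iff split: sum.split)
  ultimately show "A \<in> {A \<in> Sym n (cycle_edges n). cycle_data n A \<in> matrix_data n ` psd_trace_one n}"
    using A by auto
next
  fix A assume "A \<in> {A \<in> Sym n (cycle_edges n). cycle_data n A \<in> matrix_data n ` psd_trace_one n}"
  then obtain N where A: "A \<in> Sym n (cycle_edges n)" and N: "N \<in> psd_trace_one n"
    and eq: "cycle_data n A = matrix_data n N" by auto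
  have eq1: "N (i, i) = A (Inl i) \<and> N (i, cyc_succ n i) = A (Inr {i, cyc_succ n i})" if "i \<in> {1..n}" for i
    using that fun_cong[OF eq, of "Inl i"] fun_cong[OF eq, of "Inr i"]
    by (simp add: cycle_data_def matrix_data_def)
  have "tr n A = (\<Sum>i=1..n. N (i, i))"
    unfolding tr_def using eq1 by (intro sum.cong) (auto simp: entry_def)
  moreover have "A \<in> SigmaG n (cycle_edges n)"
    unfolding in_SigmaG_cycle_iff[OF n] using A N eq1
    by (auto simp: psd_trace_one_def intro!: exI[of _ "\<lambda>i j. N (i, j)"])
  ultimately show "A \<in> Sigma_bar n (cycle_edges n)"
    using A N by (simp add: Sigma_bar_def trace_hyperplane_def psd_trace_one_def)
qed

section \<open>Measurable sets in the hyperplane and the chart\<close>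

lemma space_PiM_indices: "space (\<Pi>\<^sub>M k\<in>indices n E. lborel) = Sym n E"
  by (simp add: space_PiM Sym_def)

lemma measurable_PiM_component_real:
  "k \<in> I \<Longrightarrow> (\<lambda>x. x k :: real) \<in> borel_measurable (\<Pi>\<^sub>M k\<in>I. lborel)"
  by (metis measurable_component_singleton measurable_lborel1)

lemma Inl_in_indices: "i \<in> {1..n} \<Longrightarrow> Inl i \<in> indices n E"
  by (auto simp: indices_def)

lemma Inr_in_indices_cycle: "i \<in> {1..n} \<Longrightarrow> Inr {i, cyc_succ n i} \<in> indices n (cycle_edges n)"
  using cycle_edges_eq[of n] by (auto simp: indices_def)

text \<open>\<open>cycle_data n\<close> is measurable coordinate by coordinate and
  \<open>nat + nat\<close> is countable, so preimages of compact sets are measurable.\<close>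

lemma sets_Sigma_bar_cycle:
  assumes n: "n \<ge> 3"
  shows "Sigma_bar n (cycle_edges n) \<in> sets (\<Pi>\<^sub>M k\<in>indices n (cycle_edges n). lborel)"
proof -
  let ?M = "\<Pi>\<^sub>M k\<in>indices n (cycle_edges n). (lborel :: real measure)"
  have "(\<lambda>A. cycle_data n A k) \<in> borel_measurable ?M" for k
  proof (cases k)
    case (Inl i)
    then show ?thesis
      using measurable_PiM_component_real[OF Inl_in_indices, of i n "cycle_edges n"]
      by (cases "i \<in> {1..n}") (simp_all add: cycle_data_def del: atLeastAtMost_iff)
  next
    case (Inr i)
    then show ?thesis
      using measurable_PiM_component_real[OF Inr_in_indices_cycle, of i n]
      by (cases "i \<in> {1..n}") (simp_all add: cycle_data_def del: atLeastAtMost_iff)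
  qed
  then have "cycle_data n \<in> borel_measurable ?M"
    by (rule measurable_coordinatewise_then_product)
  then have "cycle_data n -` (matrix_data n ` psd_trace_one n) \<inter> space ?M \<in> sets ?M"
    using borel_closed[OF compact_imp_closed[OF compact_matrix_data_image]]
    by (rule measurable_sets)
  also have "cycle_data n -` (matrix_data n ` psd_trace_one n) \<inter> space ?M = Sigma_bar n (cycle_edges n)"
    unfolding Sigma_bar_cycle_eq[OF n] space_PiM_indices by auto
  finally show ?thesis .
qed

lemma sets_trace_hyperplane:
  "trace_hyperplane n E \<in> sets (\<Pi>\<^sub>M k\<in>indices n E. lborel)"
proof -
  let ?M = "\<Pi>\<^sub>M k\<in>indices n E. (lborel :: real measure)"
  have "(\<lambda>A. tr n A) \<in> borel_measurable ?M"
    using measurable_PiM_component_real[OF Inl_in_indices]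
    by (auto simp: tr_def entry_def intro!: borel_measurable_sum)
  then have "(\<lambda>A. tr n A) -` {1} \<inter> space ?M \<in> sets ?M"
    by (rule measurable_sets) simp
  also have "(\<lambda>A. tr n A) -` {1} \<inter> space ?M = trace_hyperplane n E"
    by (auto simp: trace_hyperplane_def space_PiM_indices)
  finally show ?thesis .
qed

lemma sets_P_bar_cycle:
  assumes n: "n \<ge> 4"
  shows "P_bar n (cycle_edges n) \<in> sets (\<Pi>\<^sub>M k\<in>indices n (cycle_edges n). lborel)"
proof -
  let ?M = "\<Pi>\<^sub>M k\<in>indices n (cycle_edges n). (lborel :: real measure)"
  have "{A \<in> space ?M. \<forall>i\<in>{1..n}. A (Inl i) \<ge> 0 \<and>
      \<bar>A (Inr {i, cyc_succ n i})\<bar> \<le> sqrt (A (Inl i) * A (Inl (cyc_succ n i)))} \<in> sets ?M"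
  proof (intro sets.sets_Collect_finite_All sets.sets_Collect_conj)
    fix i assume i: "i \<in> {1..n}"
    note [measurable] = measurable_PiM_component_real[OF Inl_in_indices[OF i]]
      measurable_PiM_component_real[OF Inr_in_indices_cycle[OF i]]
      measurable_PiM_component_real[OF Inl_in_indices[OF cyc_succ_in[OF i]]]
    show "{A \<in> space ?M. A (Inl i) \<ge> 0} \<in> sets ?M" by measurable
    show "{A \<in> space ?M. \<bar>A (Inr {i, cyc_succ n i})\<bar> \<le> sqrt (A (Inl i) * A (Inl (cyc_succ n i)))} \<in> sets ?M"
      by measurable
  qed simp
  also have "{A \<in> space ?M. \<forall>i\<in>{1..n}. A (Inl i) \<ge> 0 \<and>
      \<bar>A (Inr {i, cyc_succ n i})\<bar> \<le> sqrt (A (Inl i) * A (Inl (cyc_succ n i)))} = PG n (cycle_edges n)"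
    using in_PG_cycle_iff[OF n] by (auto simp: space_PiM_indices)
  finally show ?thesis
    unfolding P_bar_def using sets_trace_hyperplane by (rule sets.Int)
qed

text \<open>Completion does not change the measure of a set that is already measurable, and the
  image measure is that of the preimage under the chart. The factor \<open>sqrt (real n)\<close>
  later cancels in the ratio.\<close>

lemma Vol_eq:
  assumes n: "n \<ge> 1" and S: "S \<in> sets (\<Pi>\<^sub>M k\<in>indices n E. lborel)" "S \<subseteq> trace_hyperplane n E"
  shows "Vol n E S = sqrt (real n) *
    measure (\<Pi>\<^sub>M k\<in>free_indices n E. lborel)
      {x \<in> space (\<Pi>\<^sub>M k\<in>free_indices n E. lborel). hyperplane_chart n x \<in> S}"
proof -
  let ?R = "restrict_space (\<Pi>\<^sub>M k\<in>indices n E. (lborel :: real measure)) (trace_hyperplane n E)"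
  have "trace_hyperplane n E \<inter> S = S" using S by auto
  then have SR: "S \<in> sets ?R" unfolding sets_restrict_space using S by (metis image_eqI)
  have "Vol n E S = sqrt (real n) *
      measure (distr (\<Pi>\<^sub>M k\<in>free_indices n E. lborel) ?R (hyperplane_chart n)) S"
    unfolding Vol_def hyperplane_lebesgue_def
    by (subst measure_completion) (simp_all add: SR)
  also have "measure (distr (\<Pi>\<^sub>M k\<in>free_indices n E. lborel) ?R (hyperplane_chart n)) S =
      measure (\<Pi>\<^sub>M k\<in>free_indices n E. lborel)
        (hyperplane_chart n -` S \<inter> space (\<Pi>\<^sub>M k\<in>free_indices n E. lborel))"
    by (rule measure_distr[OF measurable_hyperplane_chart[OF n] SR])
  also have "hyperplane_chart n -` S \<inter> space (\<Pi>\<^sub>M k\<in>free_indices n E. lborel) =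
      {x \<in> space (\<Pi>\<^sub>M k\<in>free_indices n E. lborel). hyperplane_chart n x \<in> S}"
    by auto
  finally show ?thesis .
qed

section \<open>Volume estimate\<close>

definition chart_preimage :: "nat \<Rightarrow> nat set set \<Rightarrow> pmat set \<Rightarrow> pmat set" where
  "chart_preimage n E S =
     {x \<in> space (\<Pi>\<^sub>M k\<in>free_indices n E. lborel). hyperplane_chart n x \<in> S}"

lemma sets_chart_preimage:
  assumes "n \<ge> 1" "S \<in> sets (\<Pi>\<^sub>M k\<in>indices n E. lborel)"
  shows "chart_preimage n E S \<in> sets (\<Pi>\<^sub>M k\<in>free_indices n E. lborel)"
proof -
  have "hyperplane_chart n \<in>
      measurable (\<Pi>\<^sub>M k\<in>free_indices n E. lborel) (\<Pi>\<^sub>M k\<in>indices n E. lborel)"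
    using measurable_hyperplane_chart[OF assms(1)] by (simp add: measurable_restrict_space2_iff)
  from measurable_sets[OF this assms(2)] show ?thesis
    by (simp add: chart_preimage_def vimage_def Int_def conj_commute)
qed

lemma free_indices_cycle:
  assumes "n \<ge> 1"
  shows "free_indices n (cycle_edges n) = Inl ` {2..n} \<union> Inr ` cycle_edges n"
  using assms by (auto simp: free_indices_def indices_def)

lemma finite_free_indices_cycle: "n \<ge> 1 \<Longrightarrow> finite (free_indices n (cycle_edges n))"
  by (simp add: free_indices_cycle) (simp add: cycle_edges_eq)

text \<open>The volume of a box whose coordinates are edges, while its sides are indexed by the edge
  numbers \<open>i\<close>.\<close>

lemma emeasure_PiM_lborel_image:
  fixes T :: "'i \<Rightarrow> real set"
  assumes "finite I" "inj_on f I" "\<And>i. i \<in> I \<Longrightarrow> T i \<in> sets borel"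
  shows "emeasure (\<Pi>\<^sub>M k\<in>f ` I. lborel) {y \<in> space (\<Pi>\<^sub>M k\<in>f ` I. lborel). \<forall>i\<in>I. y (f i) \<in> T i} =
    (\<Prod>i\<in>I. emeasure lborel (T i))"
proof -
  interpret product_sigma_finite "\<lambda>_. lborel :: real measure" by standard
  let ?g = "the_inv_into I f"
  have g: "?g (f i) = i" if "i \<in> I" for i
    using assms that by (simp add: the_inv_into_f_f)
  have "{y \<in> space (\<Pi>\<^sub>M k\<in>f ` I. lborel). \<forall>i\<in>I. y (f i) \<in> T i} = (\<Pi>\<^sub>E k\<in>f ` I. T (?g k))"
    by (auto simp: space_PiM PiE_iff extensional_def g)
  moreover have "emeasure (\<Pi>\<^sub>M k\<in>f ` I. lborel) (\<Pi>\<^sub>E k\<in>f ` I. T (?g k)) =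
      (\<Prod>k\<in>f ` I. emeasure lborel (T (?g k)))"
    using assms g by (intro emeasure_PiM) auto
  moreover have "\<dots> = (\<Prod>i\<in>I. emeasure lborel (T i))"
    using assms by (simp add: prod.reindex g)
  ultimately show ?thesis by simp
qed

text \<open>The largest absolute value of the edge entry that a nonnegative diagonal allows.\<close>

definition edge_radius :: "nat \<Rightarrow> pmat \<Rightarrow> nat \<Rightarrow> real" where
  "edge_radius n A i = sqrt (A (Inl i) * A (Inl (cyc_succ n i)))"

text \<open>Over each diagonal the edge entries fill a product of sets that depend on the radii.
  Both \<open>P_bar\<close> and the exceptional sets \<open>few_small_edges\<close> have this shape,
  so a single comparison serves for them.\<close>

definition trace_box :: "nat \<Rightarrow> (nat \<Rightarrow> real \<Rightarrow> real set) \<Rightarrow> pmat set" where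
  "trace_box n T = {A \<in> trace_hyperplane n (cycle_edges n).
     \<forall>i\<in>{1..n}. A (Inl i) \<ge> 0 \<and> A (Inr {i, cyc_succ n i}) \<in> T i (edge_radius n A i)}"

text \<open>The diagonal, including the first entry supplied by the chart, depends only on the
  diagonal coordinates \<open>d\<close>.\<close>

lemma hyperplane_chart_merge:
  assumes "i \<in> {1..n}"
  shows "hyperplane_chart n (merge (Inl ` {2..n}) J (d, e)) (Inl i) = hyperplane_chart n d (Inl i)"
proof -
  have "merge (Inl ` {2..n}) J (d, e) (Inl j) = d (Inl j)" if "j \<in> {2..n}" for j
    using that by (auto simp: merge_def)
  moreover from this have "(\<Sum>j=2..n. merge (Inl ` {2..n}) J (d, e) (Inl j)) = (\<Sum>j=2..n. d (Inl j))"
    by (intro sum.cong) auto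
  ultimately show ?thesis using assms by (cases "i = 1") (auto simp: hyperplane_chart_def)
qed

text \<open>Fixing \<open>d\<close> fixes all radii, so the slice is a product, or empty if some
  diagonal entry is negative.\<close>

lemma emeasure_trace_box_slice:
  assumes n: "n \<ge> 3" and T: "\<And>i r. T i r \<in> sets borel"
    and d: "d \<in> space (\<Pi>\<^sub>M k\<in>Inl ` {2..n}. lborel)"
  shows "emeasure (\<Pi>\<^sub>M k\<in>Inr ` cycle_edges n. lborel)
      ((\<lambda>e. merge (Inl ` {2..n}) (Inr ` cycle_edges n) (d, e)) -`
          chart_preimage n (cycle_edges n) (trace_box n T) \<inter>
        space (\<Pi>\<^sub>M k\<in>Inr ` cycle_edges n. lborel)) =
    (if \<forall>i\<in>{1..n}. hyperplane_chart n d (Inl i) \<ge> 0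
     then \<Prod>i=1..n. emeasure lborel (T i (edge_radius n (hyperplane_chart n d) i)) else 0)"
    (is "emeasure ?M (?f -` _ \<inter> _) = ?R")
proof -
  define f :: "nat \<Rightarrow> nat + nat set" where "f i = Inr {i, cyc_succ n i}" for i
  have n1: "n \<ge> 1" using n by simp
  have M: "Inr ` cycle_edges n = f ` {1..n}"
    using cycle_edges_eq[of n] n by (simp add: f_def image_image)
  have inj: "inj_on f {1..n}"
    using inj_on_cycle_edge[OF n] by (simp only: inj_on_def f_def sum.inject)
  have sp: "?f e \<in> space (\<Pi>\<^sub>M k\<in>free_indices n (cycle_edges n). lborel)" if "e \<in> space ?M" for e
    using that d unfolding space_PiM free_indices_cycle[OF n1]
    by (auto simp: PiE_iff extensional_def merge_def)
  have hyp: "hyperplane_chart n (?f e) \<in> trace_hyperplane n (cycle_edges n)" if "e \<in> space ?M" for e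
    using sp[OF that] n by (intro chart_in_hyperplane) (auto simp: space_PiM)
  have rad: "edge_radius n (hyperplane_chart n (?f e)) i = edge_radius n (hyperplane_chart n d) i"
    if "i \<in> {1..n}" for e i
    using that cyc_succ_in[OF that] by (simp only: edge_radius_def hyperplane_chart_merge)
  have edge: "hyperplane_chart n (?f e) (Inr {i, cyc_succ n i}) = e (f i)" if "i \<in> {1..n}" for e i
  proof -
    have "f i \<in> Inr ` cycle_edges n" unfolding M using that by simp
    then show ?thesis by (auto simp: hyperplane_chart_def merge_def f_def)
  qed
  have *: "?f -` chart_preimage n (cycle_edges n) (trace_box n T) \<inter> space ?M =
    (if \<forall>i\<in>{1..n}. hyperplane_chart n d (Inl i) \<ge> 0
     then {e \<in> space ?M. \<forall>i\<in>{1..n}. e (f i) \<in> T i (edge_radius n (hyperplane_chart n d) i)} else {})"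
    using sp hyp unfolding chart_preimage_def trace_box_def
    by (auto simp: rad edge hyperplane_chart_merge simp del: atLeastAtMost_iff)
  show ?thesis
    unfolding * unfolding M using emeasure_PiM_lborel_image[OF _ inj, of "\<lambda>i. T i (edge_radius n (hyperplane_chart n d) i)"] T
    by simp
qed

text \<open>The sides are compared in each slice and the result is integrated over the diagonals by
  Tonelli's theorem. Radii \<open>r \<ge> 0\<close> suffice, as other diagonals have empty
  slices.\<close>

lemma emeasure_trace_box_mono:
  assumes n: "n \<ge> 3" and T: "\<And>i r. T i r \<in> sets borel" "\<And>i r. T' i r \<in> sets borel"
    and S: "trace_box n T \<in> sets (\<Pi>\<^sub>M k\<in>indices n (cycle_edges n). lborel)"
      "trace_box n T' \<in> sets (\<Pi>\<^sub>M k\<in>indices n (cycle_edges n). lborel)"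
    and le: "\<And>i r. i \<in> {1..n} \<Longrightarrow> r \<ge> 0 \<Longrightarrow>
      emeasure lborel (T i r) \<le> c i * emeasure lborel (T' i r)"
  shows "emeasure (\<Pi>\<^sub>M k\<in>free_indices n (cycle_edges n). lborel)
      (chart_preimage n (cycle_edges n) (trace_box n T)) \<le> (\<Prod>i=1..n. c i) *
    emeasure (\<Pi>\<^sub>M k\<in>free_indices n (cycle_edges n). lborel)
      (chart_preimage n (cycle_edges n) (trace_box n T'))"
proof -
  interpret product_sigma_finite "\<lambda>_. lborel :: real measure" by standard
  let ?D = "Inl ` {2..n} :: (nat + nat set) set" and ?J = "Inr ` cycle_edges n :: (nat + nat set) set"
  have n1: "n \<ge> 1" using n by simp
  note fi = free_indices_cycle[OF n1]
  have fin: "?D \<inter> ?J = {}" "finite ?D" "finite ?J"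
    using cycle_edges_eq[OF n1] by auto
  have X: "chart_preimage n (cycle_edges n) (trace_box n T) \<in> sets (\<Pi>\<^sub>M k\<in>?D \<union> ?J. lborel)"
    "chart_preimage n (cycle_edges n) (trace_box n T') \<in> sets (\<Pi>\<^sub>M k\<in>?D \<union> ?J. lborel)"
    using sets_chart_preimage[OF n1 S(1)] sets_chart_preimage[OF n1 S(2)] by (simp_all only: fi)
  define g where "g T d = emeasure (\<Pi>\<^sub>M k\<in>?J. lborel) ((\<lambda>e. merge ?D ?J (d, e)) -`
      chart_preimage n (cycle_edges n) (trace_box n T) \<inter> space (\<Pi>\<^sub>M k\<in>?J. lborel))" for T d
  have g_le: "g T d \<le> (\<Prod>i=1..n. c i) * g T' d" if d: "d \<in> space (\<Pi>\<^sub>M k\<in>?D. lborel)" for d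
  proof (cases "\<forall>i\<in>{1..n}. hyperplane_chart n d (Inl i) \<ge> 0")
    case nonneg: True
    have r: "edge_radius n (hyperplane_chart n d) i \<ge> 0" if "i \<in> {1..n}" for i
      using nonneg that cyc_succ_in[OF that] by (simp add: edge_radius_def del: atLeastAtMost_iff)
    have "(\<Prod>i=1..n. emeasure lborel (T i (edge_radius n (hyperplane_chart n d) i))) \<le>
      (\<Prod>i=1..n. c i) * (\<Prod>i=1..n. emeasure lborel (T' i (edge_radius n (hyperplane_chart n d) i)))"
      unfolding prod.distrib[symmetric] by (intro prod_mono_ennreal le r)
    then show ?thesis
      unfolding g_def emeasure_trace_box_slice[OF n T(1) d] emeasure_trace_box_slice[OF n T(2) d]
      by (simp only: if_P[OF nonneg])
  next
    case False
    then show ?thesis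
      unfolding g_def emeasure_trace_box_slice[OF n T(1) d] emeasure_trace_box_slice[OF n T(2) d]
      by (simp only: if_not_P) simp
  qed
  have "(\<integral>\<^sup>+ d. g T d \<partial>(\<Pi>\<^sub>M k\<in>?D. lborel)) \<le> (\<integral>\<^sup>+ d. (\<Prod>i=1..n. c i) * g T' d \<partial>(\<Pi>\<^sub>M k\<in>?D. lborel))"
    by (intro nn_integral_mono g_le)
  also have "\<dots> = (\<Prod>i=1..n. c i) * (\<integral>\<^sup>+ d. g T' d \<partial>(\<Pi>\<^sub>M k\<in>?D. lborel))"
    unfolding g_def by (intro nn_integral_cmult emeasure_fold_measurable fin X)
  finally show ?thesis
    unfolding fi emeasure_fold_integral[OF fin X(1)] emeasure_fold_integral[OF fin X(2)] g_def .
qed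

section \<open>The exceptional sets with few small edges\<close>

lemma P_bar_eq_trace_box:
  assumes "n \<ge> 4"
  shows "P_bar n (cycle_edges n) = trace_box n (\<lambda>i r. {-r..r})"
proof -
  have "y \<in> {-r..r} \<longleftrightarrow> \<bar>y\<bar> \<le> r" for r y :: real by auto
  then show ?thesis
    unfolding P_bar_def trace_box_def trace_hyperplane_def edge_radius_def
    using in_PG_cycle_iff[OF assms] by blast
qed

text \<open>Members of \<open>P_bar\<close> whose only edges with a small entry may be the edges \<open>p\<close> and \<open>q\<close>.\<close>

definition few_small_edges :: "nat \<Rightarrow> nat \<Rightarrow> nat \<Rightarrow> pmat set" where
  "few_small_edges n p q =
     trace_box n (\<lambda>i r. if i \<in> {p, q} then {-r..r} else {-r..r} - {-r/2..r/2})"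

lemma few_small_edges_eq:
  assumes "n \<ge> 4"
  shows "few_small_edges n p q = {A \<in> P_bar n (cycle_edges n).
    \<forall>i\<in>{1..n} - {p, q}. edge_radius n A i / 2 < \<bar>A (Inr {i, cyc_succ n i})\<bar>}"
proof -
  have "y \<in> {-r..r} - {-r/2..r/2} \<longleftrightarrow> y \<in> {-r..r} \<and> r / 2 < \<bar>y\<bar>" for r y :: real
    by auto
  then show ?thesis
    unfolding few_small_edges_def P_bar_eq_trace_box[OF assms] trace_box_def by auto
qed

lemma sets_few_small_edges:
  assumes n: "n \<ge> 4"
  shows "few_small_edges n p q \<in> sets (\<Pi>\<^sub>M k\<in>indices n (cycle_edges n). lborel)"
proof -
  let ?M = "\<Pi>\<^sub>M k\<in>indices n (cycle_edges n). (lborel :: real measure)"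
  have "{A \<in> space ?M. \<forall>i\<in>{1..n} - {p, q}. edge_radius n A i / 2 < \<bar>A (Inr {i, cyc_succ n i})\<bar>} \<in> sets ?M"
  proof (intro sets.sets_Collect_finite_All)
    fix i assume "i \<in> {1..n} - {p, q}"
    then have i: "i \<in> {1..n}" by simp
    note [measurable] = measurable_PiM_component_real[OF Inl_in_indices[OF i]]
      measurable_PiM_component_real[OF Inr_in_indices_cycle[OF i]]
      measurable_PiM_component_real[OF Inl_in_indices[OF cyc_succ_in[OF i]]]
    show "{A \<in> space ?M. edge_radius n A i / 2 < \<bar>A (Inr {i, cyc_succ n i})\<bar>} \<in> sets ?M"
      unfolding edge_radius_def by measurable
  qed simp
  with sets_P_bar_cycle[OF n] have "P_bar n (cycle_edges n) \<inter>
    {A \<in> space ?M. \<forall>i\<in>{1..n} - {p, q}. edge_radius n A i / 2 < \<bar>A (Inr {i, cyc_succ n i})\<bar>} \<in> sets ?M"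
    by (rule sets.Int)
  also have "P_bar n (cycle_edges n) \<inter>
    {A \<in> space ?M. \<forall>i\<in>{1..n} - {p, q}. edge_radius n A i / 2 < \<bar>A (Inr {i, cyc_succ n i})\<bar>} = few_small_edges n p q"
    unfolding few_small_edges_eq[OF n] using sets.sets_into_space[OF sets_P_bar_cycle[OF n]] by blast
  finally show ?thesis .
qed

text \<open>A member of \<open>P_bar\<close> whose small edges are not covered by any pair
  \<open>p\<close>, \<open>q\<close> has three of them, hence a completion.\<close>

lemma P_bar_minus_Sigma_bar_subset:
  assumes n: "n \<ge> 4"
  shows "P_bar n (cycle_edges n) - Sigma_bar n (cycle_edges n) \<subseteq>
    (\<Union>(p, q)\<in>{1..n} \<times> {1..n}. few_small_edges n p q)"
proof (rule subsetI, rule ccontr)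
  fix A assume A: "A \<in> P_bar n (cycle_edges n) - Sigma_bar n (cycle_edges n)"
    and "A \<notin> (\<Union>(p, q)\<in>{1..n} \<times> {1..n}. few_small_edges n p q)"
  then have many: "\<exists>i\<in>{1..n} - {p, q}. \<bar>A (Inr {i, cyc_succ n i})\<bar> \<le> edge_radius n A i / 2"
    if "p \<in> {1..n}" "q \<in> {1..n}" for p q
    using that unfolding few_small_edges_eq[OF n] by (fastforce simp: not_less)
  define S where "S = {i\<in>{1..n}. \<bar>A (Inr {i, cyc_succ n i})\<bar> \<le> edge_radius n A i / 2}"
  have many': "\<exists>i\<in>S. i \<notin> {p, q}" if "p \<in> {1..n}" "q \<in> {1..n}" for p q
    using many[OF that] unfolding S_def by blast
  have "S \<subseteq> {1..n}" by (auto simp: S_def)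
  \<comment> \<open>Small edges are picked one by one, with \<open>p\<close> and \<open>q\<close>
    set to those already found; the first pair \<open>1\<close>, \<open>1\<close> is
    arbitrary.\<close>
  from many'[of 1 1] n obtain a where a: "a \<in> S" by auto
  from many'[of a a] a \<open>S \<subseteq> {1..n}\<close> obtain b where b: "b \<in> S" "b \<noteq> a" by blast
  from many'[of a b] a b \<open>S \<subseteq> {1..n}\<close> obtain c where c: "c \<in> S" "c \<noteq> a" "c \<noteq> b" by blast
  obtain p q r where pqr: "p < q" "q < r" "{p, q, r} \<subseteq> S"
  proof -
    have "\<exists>p q r. p < q \<and> q < r \<and> {p, q, r} = {a, b, c}"
      using b c by (metis insert_commute linorder_neqE_nat)
    then show ?thesis using that a b c by (metis empty_subsetI insert_subset)
  qed
  have "A \<in> SigmaG n (cycle_edges n)"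
    using A pqr \<open>S \<subseteq> {1..n}\<close> n
    by (intro in_SigmaG_cycle_if_three_small[of n A p q r])
       (auto simp: P_bar_def S_def edge_radius_def)
  with A show False by (simp add: P_bar_def Sigma_bar_def)
qed

text \<open>Removing the middle half of an interval halves its length, and this happens at
  \<open>n - 2\<close> or more edges; \<open>4 / 2 ^ n\<close> is
  \<open>(1/2) ^ (n - 2)\<close>.\<close>

lemma emeasure_few_small_edges_le:
  assumes n: "n \<ge> 4"
  shows "emeasure (\<Pi>\<^sub>M k\<in>free_indices n (cycle_edges n). lborel)
      (chart_preimage n (cycle_edges n) (few_small_edges n p q)) \<le> ennreal (4 / 2 ^ n) *
    emeasure (\<Pi>\<^sub>M k\<in>free_indices n (cycle_edges n). lborel)
      (chart_preimage n (cycle_edges n) (P_bar n (cycle_edges n)))"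
proof -
  define c :: "nat \<Rightarrow> real" where "c i = (if i \<in> {p, q} then 1 else 1/2)" for i
  have "(\<Prod>i=1..n. c i) = (\<Prod>i\<in>{1..n} - {p, q}. 1/2)"
    unfolding c_def by (intro prod.mono_neutral_cong_right) auto
  also have "\<dots> = (1/2) ^ card ({1..n} - {p, q})" by simp
  \<comment> \<open>Only an inequality, since \<open>p\<close> and \<open>q\<close> may coincide or
    lie outside \<open>{1..n}\<close>.\<close>
  also have "\<dots> \<le> (1/2) ^ (n - 2)"
  proof (rule power_decreasing)
    have "card {p, q} \<le> 2" by (simp add: card_insert_if)
    then show "n - 2 \<le> card ({1..n} - {p, q})"
      using diff_card_le_card_Diff[of "{p, q}" "{1..n}"] by simp
  qed auto
  also have "\<dots> = 4 / 2 ^ n"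
    using n by (simp add: power_diff power_divide)
  finally have c: "(\<Prod>i=1..n. c i) \<le> 4 / 2 ^ n" .
  have half: "emeasure lborel ({-r..r} - {-r/2..r/2}) \<le> ennreal (1/2) * emeasure lborel {-r..r}"
    if "r \<ge> 0" for r :: real
  proof -
    have "emeasure lborel ({-r..r} - {-r/2..r/2}) = ennreal (r - -r) - ennreal (r/2 - -r/2)"
      using that by (subst emeasure_Diff) auto
    also have "\<dots> = ennreal (1/2 * (r - -r))"
      using that by (simp add: ennreal_minus)
    also have "\<dots> = ennreal (1/2) * ennreal (r - -r)"
      using that by (intro ennreal_mult) auto
    finally show ?thesis using that by simp
  qed
  have "emeasure (\<Pi>\<^sub>M k\<in>free_indices n (cycle_edges n). lborel)
      (chart_preimage n (cycle_edges n) (few_small_edges n p q)) \<le> (\<Prod>i=1..n. ennreal (c i)) *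
    emeasure (\<Pi>\<^sub>M k\<in>free_indices n (cycle_edges n). lborel)
      (chart_preimage n (cycle_edges n) (P_bar n (cycle_edges n)))"
    unfolding few_small_edges_def P_bar_eq_trace_box[OF n]
  proof (rule emeasure_trace_box_mono)
    show "emeasure lborel (if i \<in> {p, q} then {-r..r} else {-r..r} - {-r/2..r/2}) \<le>
        ennreal (c i) * emeasure lborel {-r..r}" if "r \<ge> 0" for i and r :: real
      using half[OF that] by (simp add: c_def)
  qed (use n sets_few_small_edges[OF n, of p q] sets_P_bar_cycle[OF n]
       in \<open>auto simp: few_small_edges_def P_bar_eq_trace_box[OF n]\<close>)
  also have "(\<Prod>i=1..n. ennreal (c i)) = ennreal (\<Prod>i=1..n. c i)"
    by (intro prod_ennreal) (auto simp: c_def)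
  also have "ennreal (\<Prod>i=1..n. c i) * emeasure (\<Pi>\<^sub>M k\<in>free_indices n (cycle_edges n). lborel)
      (chart_preimage n (cycle_edges n) (P_bar n (cycle_edges n))) \<le> ennreal (4 / 2 ^ n) *
      emeasure (\<Pi>\<^sub>M k\<in>free_indices n (cycle_edges n). lborel)
      (chart_preimage n (cycle_edges n) (P_bar n (cycle_edges n)))"
    using c by (intro mult_right_mono ennreal_leI) auto
  finally show ?thesis .
qed

section \<open>The volume of \<open>P_bar\<close> is finite and positive\<close>

text \<open>Nonnegative diagonal entries of sum one are at most \<open>1\<close>, hence so are the
  radii, and \<open>P_bar\<close> lies in a cube.\<close>

lemma emeasure_chart_preimage_P_bar_finite:
  assumes n: "n \<ge> 4"
  shows "emeasure (\<Pi>\<^sub>M k\<in>free_indices n (cycle_edges n). lborel)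
    (chart_preimage n (cycle_edges n) (P_bar n (cycle_edges n))) < \<infinity>"
proof -
  interpret product_sigma_finite "\<lambda>_. lborel :: real measure" by standard
  let ?I = "free_indices n (cycle_edges n)"
  have n1: "n \<ge> 1" using n by simp
  note fin = finite_free_indices_cycle[OF n1]
  have "x k \<in> {-1..1}" if x: "x \<in> chart_preimage n (cycle_edges n) (P_bar n (cycle_edges n))"
    and k: "k \<in> ?I" for x k
  proof -
    define A where "A = hyperplane_chart n x"
    have "A \<in> trace_box n (\<lambda>i r. {-r..r})"
      using x unfolding chart_preimage_def P_bar_eq_trace_box[OF n] A_def by blast
    then have A: "A \<in> trace_hyperplane n (cycle_edges n)" and nonneg: "\<And>i. i \<in> {1..n} \<Longrightarrow> A (Inl i) \<ge> 0"
      and edge: "\<And>i. i \<in> {1..n} \<Longrightarrow> \<bar>A (Inr {i, cyc_succ n i})\<bar> \<le> edge_radius n A i"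
      by (simp_all add: trace_box_def abs_le_iff minus_le_iff)
    have "(\<Sum>i=1..n. A (Inl i)) = 1" using A by (simp add: trace_hyperplane_def tr_def entry_def)
    then have le1: "A (Inl i) \<le> 1" if "i \<in> {1..n}" for i
      using member_le_sum[of i "{1..n}" "\<lambda>i. A (Inl i)"] nonneg that by simp
    have xA: "x k = A k" using k by (auto simp: A_def hyperplane_chart_def free_indices_def)
    from k consider i where "i \<in> {1..n}" "k = Inl i" | i where "i \<in> {1..n}" "k = Inr {i, cyc_succ n i}"
      unfolding free_indices_cycle[OF n1] unfolding cycle_edges_eq[OF n1] by force
    then show ?thesis
    proof cases
      case (1 i)
      then show ?thesis using nonneg[of i] le1[of i] xA by simp
    next
      case (2 i)
      have "edge_radius n A i \<le> 1"
        using le1[OF 2(1)] le1[OF cyc_succ_in[OF 2(1)]] nonneg[OF 2(1)] nonneg[OF cyc_succ_in[OF 2(1)]]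
        by (simp add: edge_radius_def mult_le_one)
      then show ?thesis using edge[OF 2(1)] xA 2(2) by (simp add: abs_le_iff minus_le_iff)
    qed
  qed
  then have "chart_preimage n (cycle_edges n) (P_bar n (cycle_edges n)) \<subseteq> (\<Pi>\<^sub>E k\<in>?I. {-1..1::real})"
    by (auto simp: chart_preimage_def space_PiM PiE_iff extensional_def)
  then have "emeasure (\<Pi>\<^sub>M k\<in>?I. lborel) (chart_preimage n (cycle_edges n) (P_bar n (cycle_edges n)))
      \<le> emeasure (\<Pi>\<^sub>M k\<in>?I. lborel) (\<Pi>\<^sub>E k\<in>?I. {-1..1::real})"
    by (rule emeasure_mono) (intro sets_PiM_I_finite fin, simp)
  also have "\<dots> = (\<Prod>k\<in>?I. emeasure lborel {-1..1::real})"
    using fin by (intro emeasure_PiM) auto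
  also have "\<dots> < \<infinity>"
    by (simp add: power_less_top_ennreal)
  finally show ?thesis .
qed

text \<open>\<open>P_bar\<close> contains a box around a point with nearly equal diagonal entries
  and zero edge entries.\<close>

lemma emeasure_chart_preimage_P_bar_pos:
  assumes n: "n \<ge> 4"
  shows "emeasure (\<Pi>\<^sub>M k\<in>free_indices n (cycle_edges n). lborel)
    (chart_preimage n (cycle_edges n) (P_bar n (cycle_edges n))) > 0"
proof -
  interpret product_sigma_finite "\<lambda>_. lborel :: real measure" by standard
  let ?I = "free_indices n (cycle_edges n)"
  have n1: "n \<ge> 1" using n by simp
  note fin = finite_free_indices_cycle[OF n1]
  \<comment> \<open>With this \<open>\<delta>\<close>, \<open>n - 1\<close> diagonal entries of size
    at most \<open>2 * \<delta>\<close> sum to at most \<open>1 - 2 * \<delta>\<close>. So the first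
    entry is at least \<open>\<delta>\<close> too, and all radii are at least
    \<open>\<delta>\<close>.\<close>
  define \<delta> where "\<delta> = 1 / (2 * real n)"
  have \<delta>: "\<delta> > 0" using n by (simp add: \<delta>_def)
  define C :: "nat + nat set \<Rightarrow> real set" where
    "C k = (case k of Inl _ \<Rightarrow> {\<delta>..2 * \<delta>} | Inr _ \<Rightarrow> {-\<delta>..\<delta>})" for k
  have C: "C k \<in> sets lborel" "emeasure lborel (C k) \<noteq> 0" for k
    using \<delta> by (auto simp: C_def split: sum.split)
  have "x \<in> chart_preimage n (cycle_edges n) (P_bar n (cycle_edges n))" if x: "x \<in> (\<Pi>\<^sub>E k\<in>?I. C k)" for x
  proof -
    have xI: "Inl i \<in> ?I" if "i \<in> {2..n}" for i
      using that by (simp add: free_indices_cycle[OF n1])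
    have diag: "\<delta> \<le> x (Inl i)" "x (Inl i) \<le> 2 * \<delta>" if "i \<in> {2..n}" for i
      using PiE_mem[OF x xI[OF that]] by (auto simp: C_def)
    have "(\<Sum>i=2..n. x (Inl i)) \<le> of_nat (card {2..n}) * (2 * \<delta>)"
      by (rule sum_bounded_above) (rule diag)
    also have "\<dots> = 1 - 2 * \<delta>"
      using n by (simp add: \<delta>_def of_nat_diff field_simps)
    finally have "\<delta> \<le> 1 - (\<Sum>i=2..n. x (Inl i))" using \<delta> by simp
    then have d: "\<delta> \<le> hyperplane_chart n x (Inl i)" if "i \<in> {1..n}" for i
      using diag[of i] that by (cases "i = 1") (auto simp: hyperplane_chart_def)
    have r: "\<delta> \<le> edge_radius n (hyperplane_chart n x) i" if "i \<in> {1..n}" for i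
    proof -
      have "\<delta> * \<delta> \<le> hyperplane_chart n x (Inl i) * hyperplane_chart n x (Inl (cyc_succ n i))"
        using d[OF that] d[OF cyc_succ_in[OF that]] \<delta> by (intro mult_mono) auto
      then show ?thesis
        unfolding edge_radius_def using \<delta> by (intro real_le_rsqrt) (simp add: power2_eq_square)
    qed
    have e: "hyperplane_chart n x (Inr {i, cyc_succ n i}) \<in> {-\<delta>..\<delta>}" if "i \<in> {1..n}" for i
    proof -
      have "Inr {i, cyc_succ n i} \<in> ?I"
        unfolding free_indices_cycle[OF n1] unfolding cycle_edges_eq[OF n1] using that by blast
      from PiE_mem[OF x this] show ?thesis by (simp add: C_def hyperplane_chart_def)
    qed
    have "hyperplane_chart n x (Inl i) \<ge> 0 \<and> hyperplane_chart n x (Inr {i, cyc_succ n i}) \<in>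
        {- edge_radius n (hyperplane_chart n x) i..edge_radius n (hyperplane_chart n x) i}"
      if "i \<in> {1..n}" for i
      using d[OF that] r[OF that] e[OF that] \<delta> by simp
    moreover have xI: "x \<in> ?I \<rightarrow>\<^sub>E UNIV" using x by (auto simp: PiE_iff)
    ultimately have "hyperplane_chart n x \<in> P_bar n (cycle_edges n)"
      unfolding P_bar_eq_trace_box[OF n] trace_box_def using chart_in_hyperplane[OF n1] by blast
    then show ?thesis using xI by (simp add: chart_preimage_def space_PiM)
  qed
  then have sub: "(\<Pi>\<^sub>E k\<in>?I. C k) \<subseteq> chart_preimage n (cycle_edges n) (P_bar n (cycle_edges n))" by blast
  have "emeasure (\<Pi>\<^sub>M k\<in>?I. lborel) (\<Pi>\<^sub>E k\<in>?I. C k) = (\<Prod>k\<in>?I. emeasure lborel (C k))"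
    using fin C by (intro emeasure_PiM) auto
  also have "\<dots> \<noteq> 0" using fin C by (simp add: prod_zero_iff)
  finally show ?thesis
    using emeasure_mono[OF sub sets_chart_preimage[OF n1 sets_P_bar_cycle[OF n]]]
    by (metis not_gr_zero le_zero_eq)
qed

section \<open>The ratio of the volumes and its limit\<close>

text \<open>A union bound: \<open>n ^ 2\<close> ordered pairs \<open>(p, q)\<close>, each with at
  most the fraction \<open>4 / 2 ^ n\<close> of \<open>P_bar\<close>. The upper bound comes from
  \<open>Sigma_bar \<subseteq> P_bar\<close>.\<close>

lemma Vol_ratio_cycle_bounds:
  assumes n: "n \<ge> 4"
  defines "\<rho> \<equiv> Vol n (cycle_edges n) (Sigma_bar n (cycle_edges n)) /
    Vol n (cycle_edges n) (P_bar n (cycle_edges n))"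
  shows "1 - 4 * real n ^ 2 / 2 ^ n \<le> \<rho>" "\<rho> \<le> 1"
proof -
  let ?E = "cycle_edges n"
  let ?N = "\<Pi>\<^sub>M k\<in>free_indices n ?E. (lborel :: real measure)"
  let ?P = "chart_preimage n ?E (P_bar n ?E)" and ?S = "chart_preimage n ?E (Sigma_bar n ?E)"
    and ?B = "\<lambda>p q. chart_preimage n ?E (few_small_edges n p q)"
  have n13: "n \<ge> 1" "n \<ge> 3" using n by auto
  have SP: "Sigma_bar n ?E \<subseteq> P_bar n ?E"
    using SigmaG_subset_PG by (auto simp: Sigma_bar_def P_bar_def)
  have sets: "?P \<in> sets ?N" "?S \<in> sets ?N" "?B p q \<in> sets ?N" for p q
    using sets_chart_preimage[OF n13(1)] sets_P_bar_cycle[OF n] sets_Sigma_bar_cycle[OF n13(2)]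
      sets_few_small_edges[OF n] by blast+
  have sub: "?S \<subseteq> ?P" "?B p q \<subseteq> ?P" for p q
    using SP few_small_edges_eq[OF n] by (auto simp: chart_preimage_def)
  have Pfin: "?P \<in> fmeasurable ?N"
    using sets emeasure_chart_preimage_P_bar_finite[OF n] by (intro fmeasurableI) auto
  then have fin: "?S \<in> fmeasurable ?N" "?B p q \<in> fmeasurable ?N" for p q
    using fmeasurableI2[OF Pfin sub(1) sets(2)] fmeasurableI2[OF Pfin sub(2) sets(3)] by blast+
  have ratio: "\<rho> = measure ?N ?S / measure ?N ?P"
    unfolding \<rho>_def
    using Vol_eq[OF n13(1) sets_Sigma_bar_cycle[OF n13(2)]] Vol_eq[OF n13(1) sets_P_bar_cycle[OF n]] n
    by (simp add: Sigma_bar_def P_bar_def chart_preimage_def)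
  have pos: "measure ?N ?P > 0"
    using emeasure_chart_preimage_P_bar_pos[OF n] emeasure_eq_measure2[OF Pfin]
    by (metis ennreal_less_zero_iff)
  have B: "measure ?N (?B p q) \<le> 4 / 2 ^ n * measure ?N ?P" for p q
    using emeasure_few_small_edges_le[OF n, of p q]
    unfolding emeasure_eq_measure2[OF Pfin] emeasure_eq_measure2[OF fin(2)]
    by (simp add: ennreal_mult[symmetric])
  have "?P \<subseteq> ?S \<union> (\<Union>(p, q)\<in>{1..n} \<times> {1..n}. ?B p q)"
    using P_bar_minus_Sigma_bar_subset[OF n] by (fastforce simp: chart_preimage_def)
  then have "measure ?N ?P \<le> measure ?N (?S \<union> (\<Union>(p, q)\<in>{1..n} \<times> {1..n}. ?B p q))"
    using fin sets by (intro measure_mono_fmeasurable fmeasurable.Un fmeasurable.finite_UN) auto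
  also have "\<dots> \<le> measure ?N ?S + measure ?N (\<Union>(p, q)\<in>{1..n} \<times> {1..n}. ?B p q)"
    using sets by (intro measure_Un_le) auto
  also have "measure ?N (\<Union>(p, q)\<in>{1..n} \<times> {1..n}. ?B p q) \<le>
      (\<Sum>(p, q)\<in>{1..n} \<times> {1..n}. measure ?N (?B p q))"
    using sets measure_UNION_le[of "{1..n} \<times> {1..n}" "\<lambda>(p, q). ?B p q" ?N] 
    by (auto simp: case_prod_unfold)
  also have "\<dots> \<le> of_nat (card ({1..n} \<times> {1..n})) * (4 / 2 ^ n * measure ?N ?P)"
    using B by (intro sum_bounded_above) auto
  finally have "measure ?N ?P \<le> measure ?N ?S + 4 * real n ^ 2 / 2 ^ n * measure ?N ?P"
    by (simp add: power2_eq_square mult_ac)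
  then show "1 - 4 * real n ^ 2 / 2 ^ n \<le> \<rho>"
    unfolding ratio using pos by (simp add: field_simps)
  show "\<rho> \<le> 1"
    unfolding ratio using pos measure_mono_fmeasurable[OF sub(1) sets(2) Pfin] by simp
qed

theorem mainTheorem7:
  "(\<lambda>n. Vol n (cycle_edges n) (Sigma_bar n (cycle_edges n)) /
        Vol n (cycle_edges n) (P_bar n (cycle_edges n))) \<longlonglongrightarrow> 1"
proof (rule tendsto_sandwich)
  have "(\<lambda>n. real n ^ 2 / 2 ^ n) \<longlonglongrightarrow> 0"
  proof -
    \<comment> \<open>Written as a square, the sequence reduces to \<open>n * x ^ n\<close> with
      \<open>\<bar>x\<bar> < 1\<close>, whose limit is zero.\<close>
    have "(\<lambda>n. (real n * (1 / sqrt 2) ^ n) ^ 2) \<longlonglongrightarrow> 0 ^ 2"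
      by (intro tendsto_power powser_times_n_limit_0) simp
    moreover have "(real n * (1 / sqrt 2) ^ n) ^ 2 = real n ^ 2 / 2 ^ n" for n
    proof -
      have "(sqrt 2 ^ n) ^ 2 = (sqrt 2 ^ 2) ^ n" by (simp only: power_mult[symmetric] mult.commute)
      then show ?thesis by (simp add: power_mult_distrib power_divide)
    qed
    ultimately show ?thesis by simp
  qed
  then have "(\<lambda>n. 1 - 4 * (real n ^ 2 / 2 ^ n)) \<longlonglongrightarrow> 1 - 4 * 0" by (intro tendsto_intros)
  then show "(\<lambda>n. 1 - 4 * real n ^ 2 / 2 ^ n) \<longlonglongrightarrow> 1" by simp
  show "\<forall>\<^sub>F n in sequentially. 1 - 4 * real n ^ 2 / 2 ^ n \<le>
      Vol n (cycle_edges n) (Sigma_bar n (cycle_edges n)) / Vol n (cycle_edges n) (P_bar n (cycle_edges n))"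
    using Vol_ratio_cycle_bounds(1) by (intro eventually_sequentiallyI[of 4])
  show "\<forall>\<^sub>F n in sequentially. Vol n (cycle_edges n) (Sigma_bar n (cycle_edges n)) /
      Vol n (cycle_edges n) (P_bar n (cycle_edges n)) \<le> 1"
    using Vol_ratio_cycle_bounds(2) by (intro eventually_sequentiallyI[of 4])
qed simp



end
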